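(* Let $p$ be a point on a generic smooth surface $M$ in $\mathbb R^4$ and let $\pi$ be a $2$-plane such that the projection $P_\pi$ has a fold singularity at $p$, with ${\bf u}\in T_pM\cap\pi$ and associated normal vector ${\bf w}\in N_pM$. Then: (i) $p$ is an elliptic point or an inflection point of $M$ if and only if $P_\pi(p)$ is not an inflection of the apparent contour along $\pi$. (ii) $p$ is a hyperbolic or parabolic point of $M$ with ${\bf w}$ a binormal direction at $p$ if and only if $P_\pi(p)$ is an inflection of the apparent contour along $\pi$.
   Context: Setting. With $p$ at the origin, $M$ is in Monge form $F(x,y)=(x,y,f^1(x,y),f^2(x,y))$ with $f^1,f^2$ having zero 1-jet; $T_pM=\langle{\bf e}_1,{\bf e}_2\rangle$, $N_pM=\langle{\bf e}_3,{\bf e}_4\rangle$. "Generic" means: for a residual set of immersions; in particular the pair of quadratic forms $j^2(f^1,f^2)$ is, up to $GL(2,\mathbb R)\times GL(2,\mathbb R)$, $(x^2,y^2)$ ($p$ hyperbolic), $(x^2-y^2,xy)$ ($p$ elliptic), $(xy,y^2)$ ($p$ parabolic), or $(x^2+y^2,0)$ or $(xy,0)$ ($p$ an inflection point of $M$). A normal vector ${\bf w}\neq0$ is binormal at $p$ if the height function $h_{\bf w}=\langle\cdot,{\bf w}\rangle|_M$ has degenerate Hessian at $p$. The plane $\pi$ satisfies $\dim(T_pM\cap\pi)=1$ and is spanned by ${\bf u}=(1,\alpha,0,0)$ and ${\bf v}=(0,\lambda,\mu,\beta)$, $\mu^2+\beta^2\ne0$; ${\bf w}=(0,0,\beta,-\mu)$.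 The projection along $\pi$ is $P_\pi(x,y)=\big(y-\alpha x-\tfrac{\lambda}{\mu^2+\beta^2}(\mu f^1+\beta f^2),\ \beta f^1-\mu f^2\big)$; fold means $\mathcal A$-equivalent to $(x,y^2)$. The apparent contour is $P_\pi(\Sigma_\pi)$, the image of the singular set $\Sigma_\pi$ of $P_\pi$; in the fold case it is a regular plane curve. An inflection of a plane curve is a point where its curvature vanishes.
   Formalization: In (i), "P_π(p) is not an inflection of the apparent contour" is required for every plane π giving a fold at p, not one fixed π; for fixed π the converse fails, e.g. at a hyperbolic point with w not binormal. *)

theory Defs
  imports "HOL-Analysis.Analysis"
begin

section \<open>Smooth maps and map germs\<close>

text \<open>\<open>C\<^sup>k\<close> on an open set, by recursion over all directional derivatives.\<close>

primrec Ck_on :: "nat \<Rightarrow> 'a::euclidean_space set \<Rightarrow> ('a \<Rightarrow> 'b::real_normed_vector) \<Rightarrow> bool" where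
  "Ck_on 0 S f \<longleftrightarrow> continuous_on S f"
| "Ck_on (Suc k) S f \<longleftrightarrow> (\<forall>x\<in>S. f differentiable (at x)) \<and>
     (\<forall>v. Ck_on k S (\<lambda>x. frechet_derivative f (at x) v))"

definition smooth_on :: "'a::euclidean_space set \<Rightarrow> ('a \<Rightarrow> 'b::real_normed_vector) \<Rightarrow> bool" where
  "smooth_on S f \<longleftrightarrow> open S \<and> (\<forall>k. Ck_on k S f)"

definition diffeo_germ :: "(real^2 \<Rightarrow> real^2) \<Rightarrow> bool" where
  "diffeo_germ \<phi> \<longleftrightarrow> \<phi> 0 = 0 \<and>
     (\<exists>U V \<psi>. 0 \<in> U \<and> smooth_on U \<phi> \<and> smooth_on V \<psi> \<and> \<phi> ` U = V \<and> \<psi> ` V = U \<and>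
        (\<forall>x\<in>U. \<psi> (\<phi> x) = x) \<and> (\<forall>y\<in>V. \<phi> (\<psi> y) = y))"

definition A_equiv :: "(real^2 \<Rightarrow> real^2) \<Rightarrow> (real^2 \<Rightarrow> real^2) \<Rightarrow> bool" where
  "A_equiv f g \<longleftrightarrow> (\<exists>\<phi> \<psi>. diffeo_germ \<phi> \<and> diffeo_germ \<psi> \<and>
     (\<forall>\<^sub>F x in nhds 0. \<psi> (f x) = g (\<phi> x)))"

definition fold_germ :: "(real^2 \<Rightarrow> real^2) \<Rightarrow> bool" where
  "fold_germ f \<longleftrightarrow> A_equiv f (\<lambda>x. vector [x$1, (x$2)\<^sup>2])"

section \<open>Surfaces in Monge form\<close>

definition monge :: "(real^2 \<Rightarrow> real) \<Rightarrow> (real^2 \<Rightarrow> real) \<Rightarrow> real^2 \<Rightarrow> real^4" where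
  "monge f1 f2 x = vector [x$1, x$2, f1 x, f2 x]"

definition zero_1jet :: "(real^2 \<Rightarrow> real) \<Rightarrow> bool" where
  "zero_1jet f \<longleftrightarrow> f 0 = 0 \<and> (f has_derivative (\<lambda>_. 0)) (at 0)"

definition second_deriv :: "(real^2 \<Rightarrow> real) \<Rightarrow> real^2 \<Rightarrow> real^2 \<Rightarrow> real" where
  "second_deriv f u v = frechet_derivative (\<lambda>x. frechet_derivative f (at x) u) (at 0) v"

definition hessian :: "(real^2 \<Rightarrow> real) \<Rightarrow> real^2^2" where
  "hessian f = (\<chi> i j. second_deriv f (axis i 1) (axis j 1))"

text \<open>The 2-jet at the origin of a pair with zero 1-jets, as a pair of quadratic forms.\<close>

definition jet2 :: "(real^2 \<Rightarrow> real) \<Rightarrow> (real^2 \<Rightarrow> real) \<Rightarrow> real^2 \<Rightarrow> real^2" where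
  "jet2 f1 f2 x = vector [second_deriv f1 x x / 2, second_deriv f2 x x / 2]"

definition GL2_equiv :: "(real^2 \<Rightarrow> real^2) \<Rightarrow> (real^2 \<Rightarrow> real^2) \<Rightarrow> bool" where
  "GL2_equiv Q N \<longleftrightarrow> (\<exists>(A::real^2^2) (B::real^2^2). invertible A \<and> invertible B \<and>
     (\<forall>x. Q x = B *v N (A *v x)))"

definition hyperbolic_point :: "(real^2 \<Rightarrow> real) \<Rightarrow> (real^2 \<Rightarrow> real) \<Rightarrow> bool" where
  "hyperbolic_point f1 f2 \<longleftrightarrow>
     GL2_equiv (jet2 f1 f2) (\<lambda>x. vector [(x$1)\<^sup>2, (x$2)\<^sup>2])"

definition elliptic_point :: "(real^2 \<Rightarrow> real) \<Rightarrow> (real^2 \<Rightarrow> real) \<Rightarrow> bool" where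
  "elliptic_point f1 f2 \<longleftrightarrow>
     GL2_equiv (jet2 f1 f2) (\<lambda>x. vector [(x$1)\<^sup>2 - (x$2)\<^sup>2, x$1 * x$2])"

definition parabolic_point :: "(real^2 \<Rightarrow> real) \<Rightarrow> (real^2 \<Rightarrow> real) \<Rightarrow> bool" where
  "parabolic_point f1 f2 \<longleftrightarrow>
     GL2_equiv (jet2 f1 f2) (\<lambda>x. vector [x$1 * x$2, (x$2)\<^sup>2])"

definition inflection_point :: "(real^2 \<Rightarrow> real) \<Rightarrow> (real^2 \<Rightarrow> real) \<Rightarrow> bool" where
  "inflection_point f1 f2 \<longleftrightarrow>
     GL2_equiv (jet2 f1 f2) (\<lambda>x. vector [(x$1)\<^sup>2 + (x$2)\<^sup>2, 0]) \<or>
     GL2_equiv (jet2 f1 f2) (\<lambda>x. vector [x$1 * x$2, 0])"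

text \<open>The condition that genericity of the immersion imposes on the 2-jet at every point.\<close>

definition generic_2jet :: "(real^2 \<Rightarrow> real) \<Rightarrow> (real^2 \<Rightarrow> real) \<Rightarrow> bool" where
  "generic_2jet f1 f2 \<longleftrightarrow> hyperbolic_point f1 f2 \<or> elliptic_point f1 f2 \<or>
     parabolic_point f1 f2 \<or> inflection_point f1 f2"

definition tangent_plane :: "(real^4) set" where
  "tangent_plane = span {axis 1 1, axis 2 1}"

definition normal_plane :: "(real^4) set" where
  "normal_plane = span {axis 3 1, axis 4 1}"

definition height :: "(real^2 \<Rightarrow> real) \<Rightarrow> (real^2 \<Rightarrow> real) \<Rightarrow> real^4 \<Rightarrow> real^2 \<Rightarrow> real" where
  "height f1 f2 w x = monge f1 f2 x \<bullet> w"

definition binormal :: "(real^2 \<Rightarrow> real) \<Rightarrow> (real^2 \<Rightarrow> real) \<Rightarrow> real^4 \<Rightarrow> bool" where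
  "binormal f1 f2 w \<longleftrightarrow> w \<in> normal_plane \<and> w \<noteq> 0 \<and> det (hessian (height f1 f2 w)) = 0"

section \<open>Projection along a plane\<close>

definition dir_u :: "real \<Rightarrow> real^4" where
  "dir_u \<alpha> = vector [1, \<alpha>, 0, 0]"

definition dir_v :: "real \<Rightarrow> real \<Rightarrow> real \<Rightarrow> real^4" where
  "dir_v l \<mu> \<beta> = vector [0, l, \<mu>, \<beta>]"

definition dir_w :: "real \<Rightarrow> real \<Rightarrow> real^4" where
  "dir_w \<mu> \<beta> = vector [0, 0, \<beta>, - \<mu>]"

definition proj_along :: "real \<Rightarrow> real \<Rightarrow> real \<Rightarrow> real \<Rightarrow> real^4 \<Rightarrow> real^2" where
  "proj_along \<alpha> l \<mu> \<beta> z =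
     vector [z$2 - \<alpha> * z$1 - l / (\<mu>\<^sup>2 + \<beta>\<^sup>2) * (\<mu> * z$3 + \<beta> * z$4), \<beta> * z$3 - \<mu> * z$4]"

definition surf_proj ::
  "(real^2 \<Rightarrow> real) \<Rightarrow> (real^2 \<Rightarrow> real) \<Rightarrow> real \<Rightarrow> real \<Rightarrow> real \<Rightarrow> real \<Rightarrow> real^2 \<Rightarrow> real^2" where
  "surf_proj f1 f2 \<alpha> l \<mu> \<beta> x = proj_along \<alpha> l \<mu> \<beta> (monge f1 f2 x)"

lemma proj_along_kernel:
  assumes "\<mu>\<^sup>2 + \<beta>\<^sup>2 \<noteq> 0"
  shows "{z. proj_along \<alpha> l \<mu> \<beta> z = 0} = span {dir_u \<alpha>, dir_v l \<mu> \<beta>}"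
proof -
  have *: "proj_along \<alpha> l \<mu> \<beta> z = 0 \<longleftrightarrow> (\<exists>a b. z - a *\<^sub>R dir_u \<alpha> = b *\<^sub>R dir_v l \<mu> \<beta>)" for z
  proof
    assume "proj_along \<alpha> l \<mu> \<beta> z = 0"
    then have e1: "z$2 - \<alpha> * z$1 - l / (\<mu>\<^sup>2 + \<beta>\<^sup>2) * (\<mu> * z$3 + \<beta> * z$4) = 0"
      and e2: "\<beta> * z$3 = \<mu> * z$4"
      by (simp_all add: proj_along_def vec_eq_iff forall_2)
    define b where "b = (\<mu> * z$3 + \<beta> * z$4) / (\<mu>\<^sup>2 + \<beta>\<^sup>2)"
    have "(\<mu>\<^sup>2 + \<beta>\<^sup>2) * z$3 = \<mu> * (\<mu> * z$3 + \<beta> * z$4)"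
      "(\<mu>\<^sup>2 + \<beta>\<^sup>2) * z$4 = \<beta> * (\<mu> * z$3 + \<beta> * z$4)"
      using e2 by algebra+
    then have "z$3 = b * \<mu>" "z$4 = b * \<beta>"
      using assms by (simp_all add: b_def field_simps)
    moreover have "z$2 - z$1 * \<alpha> = b * l"
      using e1 by (simp add: b_def field_simps)
    ultimately have "z - (z$1) *\<^sub>R dir_u \<alpha> = b *\<^sub>R dir_v l \<mu> \<beta>"
      by (simp add: vec_eq_iff forall_4 dir_u_def dir_v_def vector_def)
    then show "\<exists>a b. z - a *\<^sub>R dir_u \<alpha> = b *\<^sub>R dir_v l \<mu> \<beta>" by blast
  next
    assume "\<exists>a b. z - a *\<^sub>R dir_u \<alpha> = b *\<^sub>R dir_v l \<mu> \<beta>"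
    then obtain a b where "z - a *\<^sub>R dir_u \<alpha> = b *\<^sub>R dir_v l \<mu> \<beta>" by blast
    then have "z$1 = a" "z$2 = a * \<alpha> + b * l" "z$3 = b * \<mu>" "z$4 = b * \<beta>"
      by (simp_all add: vec_eq_iff forall_4 dir_u_def dir_v_def vector_def)
    moreover have "\<mu> * (b * \<mu>) + \<beta> * (b * \<beta>) = b * (\<mu>\<^sup>2 + \<beta>\<^sup>2)"
      by algebra
    ultimately show "proj_along \<alpha> l \<mu> \<beta> z = 0"
      using assms by (auto simp: proj_along_def vec_eq_iff forall_2)
  qed
  show ?thesis
    unfolding span_breakdown_eq[of _ "dir_u \<alpha>"] set_eq_iff
    by (auto simp: * span_breakdown_eq)
qed

lemma view_plane_Int_tangent_plane:
  assumes "\<mu>\<^sup>2 + \<beta>\<^sup>2 \<noteq> 0"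
  shows "tangent_plane \<inter> span {dir_u \<alpha>, dir_v l \<mu> \<beta>} = span {dir_u \<alpha>}"
proof -
  have t: "z \<in> tangent_plane \<longleftrightarrow> z$3 = 0 \<and> z$4 = 0" for z
  proof -
    have "z - (z$1) *\<^sub>R axis 1 1 - (z$2) *\<^sub>R axis 2 1 = 0" if "z$3 = 0" "z$4 = 0"
      using that by (simp add: vec_eq_iff forall_4 axis_def)
    then show ?thesis
      unfolding tangent_plane_def span_breakdown_eq
      by (auto simp: vec_eq_iff forall_4 axis_def)
  qed
  have "\<mu> \<noteq> 0 \<or> \<beta> \<noteq> 0" using assms by auto
  then show ?thesis
    unfolding set_eq_iff Int_iff t span_breakdown_eq
    by (auto simp: vec_eq_iff forall_4 dir_u_def dir_v_def vector_def)
qed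

section \<open>Apparent contour\<close>

definition singular_set :: "(real^2) set \<Rightarrow> (real^2 \<Rightarrow> real^2) \<Rightarrow> (real^2) set" where
  "singular_set U P = {x \<in> U. det (jacobian P (at x)) = 0}"

definition apparent_contour :: "(real^2) set \<Rightarrow> (real^2 \<Rightarrow> real^2) \<Rightarrow> (real^2) set" where
  "apparent_contour U P = P ` singular_set U P"

definition plane_curvature :: "(real \<Rightarrow> real^2) \<Rightarrow> real \<Rightarrow> real" where
  "plane_curvature \<gamma> t =
     (let d1 = vector_derivative \<gamma> (at t);
          d2 = vector_derivative (\<lambda>s. vector_derivative \<gamma> (at s)) (at t)
      in (d1$1 * d2$2 - d1$2 * d2$1) / norm d1 ^ 3)"

text \<open>
  A regular parametrization of the apparent contour of \<open>P\<close> restricted to \<open>U\<close>, passing through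
  \<open>P 0\<close> at time \<open>0\<close>. It is required to factor through the singular set, so that it is the branch
  of the contour belonging to the source point \<open>0\<close> even if other branches meet \<open>P 0\<close>.
\<close>

definition contour_param ::
  "(real^2) set \<Rightarrow> (real^2 \<Rightarrow> real^2) \<Rightarrow> real \<Rightarrow> (real \<Rightarrow> real^2) \<Rightarrow> bool" where
  "contour_param U P \<epsilon> \<gamma> \<longleftrightarrow> 0 < \<epsilon> \<and> smooth_on {-\<epsilon><..<\<epsilon>} \<gamma> \<and>
     (\<forall>t\<in>{-\<epsilon><..<\<epsilon>}. vector_derivative \<gamma> (at t) \<noteq> 0) \<and>
     (\<exists>\<sigma>. smooth_on {-\<epsilon><..<\<epsilon>} \<sigma> \<and> \<sigma> 0 = 0 \<and> \<sigma> ` {-\<epsilon><..<\<epsilon>} = singular_set U P \<and>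
        (\<forall>t\<in>{-\<epsilon><..<\<epsilon>}. \<gamma> t = P (\<sigma> t)))"

lemma contour_param_image:
  "contour_param U P \<epsilon> \<gamma> \<Longrightarrow> \<gamma> ` {-\<epsilon><..<\<epsilon>} = apparent_contour U P"
  unfolding contour_param_def apparent_contour_def by (metis image_cong image_image)

text \<open>
  The contour is considered as a germ at the source point, whence the small neighbourhood \<open>W\<close>.
\<close>

definition contour_inflection :: "(real^2) set \<Rightarrow> (real^2 \<Rightarrow> real^2) \<Rightarrow> bool" where
  "contour_inflection U P \<longleftrightarrow>
     (\<exists>W \<epsilon> \<gamma>. open W \<and> 0 \<in> W \<and> W \<subseteq> U \<and> contour_param W P \<epsilon> \<gamma> \<and> plane_curvature \<gamma> 0 = 0)"

end

theory Submission
  imports Defs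
begin

text \<open>
  The projection is a germ \<open>P = (p1, p2)\<close> of the plane with \<open>dp1 = dy - \<alpha> dx\<close> and \<open>dp2 = 0\<close> at the
  origin, where \<open>p2 = \<beta> f1 - \<mu> f2\<close> is the height function in the normal direction \<open>w\<close>. Let \<open>q\<close> be the
  second derivative of \<open>p2\<close> at the origin and \<open>u = (1, \<alpha>)\<close> the kernel direction of \<open>dP\<close>. Everything is
  decided by \<open>q\<close>.

  \<^item> \<open>P\<close> is a fold if and only if \<open>q(u, u) \<noteq> 0\<close> (\<open>fold_germ_iff\<close>). The Jacobian determinant \<open>D\<close> of \<open>P\<close>
  has derivative \<open>- q(u, _)\<close> at the origin, so under this condition \<open>(p1, D)\<close> are local coordinates,
  and the normal form \<open>(x, y\<^sup>2)\<close> is reached by integrating \<open>p2\<close> along the second one.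

  \<^item> For a fold, the contour has zero curvature if and only if \<open>det q = 0\<close>, that is, if and only if \<open>w\<close>
  is binormal (\<open>contour_inflection_iff\<close>). The singular set \<open>D = 0\<close> is a regular curve whose velocity
  \<open>s\<close> is conjugate to \<open>u\<close>. The contour starts horizontally with vertical acceleration \<open>q(s, s)\<close>, and
  \<open>q(u, u) q(s, s) = det q (u \<and> s)\<^sup>2\<close>.

  It remains to see which forms occur in the pencil spanned by the 2-jets of \<open>f1\<close> and \<open>f2\<close>. At an
  elliptic point every nonzero form of the pencil is nondegenerate. At an inflection point the same
  holds, while the zero form is excluded by \<open>q(u, u) \<noteq> 0\<close>. At a hyperbolic or parabolic point the
  pencil contains the square of a nonzero linear form; choosing \<open>u\<close> outside its kernel gives a fold
  whose contour has an inflection.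
\<close>

section \<open>Calculus of smooth maps\<close>

lemma Ck_on_cong:
  assumes "open S" "Ck_on k S f" "\<And>x. x \<in> S \<Longrightarrow> f x = g x"
  shows "Ck_on k S g"
  using assms(2,3)
proof (induction k arbitrary: f g)
  case 0
  then show ?case by (simp cong: continuous_on_cong)
next
  case (Suc k)
  have g: "(g has_derivative frechet_derivative f (at x)) (at x)" if "x \<in> S" for x
  proof (rule has_derivative_transform_within_open[OF _ \<open>open S\<close> that])
    show "(f has_derivative frechet_derivative f (at x)) (at x)"
      using Suc.prems(1) that by (simp add: frechet_derivative_works)
  qed (rule Suc.prems(2))
  have "frechet_derivative f (at x) = frechet_derivative g (at x)" if "x \<in> S" for x
    by (rule frechet_derivative_at[OF g[OF that]])
  then have "Ck_on k S (\<lambda>x. frechet_derivative g (at x) v)" for v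
    using Suc.prems(1) by (intro Suc.IH[of "\<lambda>x. frechet_derivative f (at x) v"
          "\<lambda>x. frechet_derivative g (at x) v"]) simp_all
  then show ?case using g by (auto simp: differentiable_def)
qed

lemma Ck_on_SucI:
  assumes "open S" and der: "\<And>x. x \<in> S \<Longrightarrow> (f has_derivative f' x) (at x)"
    and "\<And>v. Ck_on k S (\<lambda>x. f' x v)"
  shows "Ck_on (Suc k) S f"
proof -
  have "f' x = frechet_derivative f (at x)" if "x \<in> S" for x
    using frechet_derivative_at[OF der[OF that]] .
  then have "Ck_on k S (\<lambda>x. frechet_derivative f (at x) v)" for v
    by (intro Ck_on_cong[OF assms(1,3), of v]) simp
  then show ?thesis using der by (auto simp: differentiable_def)
qed

lemma Ck_on_SucD:
  assumes "Ck_on (Suc k) S f"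
  shows "Ck_on k S f"
  using assms
proof (induction k arbitrary: f)
  case 0
  then show ?case
    by (auto intro!: continuous_at_imp_continuous_on differentiable_imp_continuous_within)
qed auto

lemma Ck_on_continuous: "Ck_on k S f \<Longrightarrow> continuous_on S f"
proof (induction k)
  case (Suc k)
  then show ?case using Ck_on_SucD by blast
qed simp

lemma Ck_on_subset:
  assumes "Ck_on k S f" "T \<subseteq> S"
  shows "Ck_on k T f"
  using assms(1)
  by (induction k arbitrary: f) (use assms(2) in \<open>auto intro: continuous_on_subset\<close>)

lemma Ck_on_const: "Ck_on k S (\<lambda>x. c)"
  by (induction k arbitrary: c) auto

lemma Ck_on_bounded_linear:
  assumes "bounded_linear L" "open S" "Ck_on k S f"
  shows "Ck_on k S (\<lambda>x. L (f x))"
  using assms(3)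
proof (induction k arbitrary: f)
  case 0
  then show ?case
    using bounded_linear.continuous_on[OF assms(1)] by simp
next
  case (Suc k)
  show ?case
  proof (rule Ck_on_SucI[OF assms(2)])
    show "((\<lambda>x. L (f x)) has_derivative (\<lambda>v. L (frechet_derivative f (at x) v))) (at x)"
      if "x \<in> S" for x
      using Suc.prems that
      by (intro bounded_linear.has_derivative[OF assms(1)]) (auto simp: frechet_derivative_works)
  qed (use Suc in auto)
qed

lemma Ck_on_id: "open S \<Longrightarrow> Ck_on k S (\<lambda>x. x)"
proof (cases k)
  case (Suc m)
  assume "open S"
  then show ?thesis
    unfolding Suc by (intro Ck_on_SucI[where f'="\<lambda>x v. v"] Ck_on_const) auto
qed simp

lemma Ck_on_add:
  assumes "open S" "Ck_on k S f" "Ck_on k S g"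
  shows "Ck_on k S (\<lambda>x. f x + g x)"
  using assms(2,3)
proof (induction k arbitrary: f g)
  case 0
  then show ?case by (auto intro: continuous_on_add)
next
  case (Suc k)
  show ?case
  proof (rule Ck_on_SucI[OF assms(1)])
    show "((\<lambda>x. f x + g x) has_derivative
        (\<lambda>v. frechet_derivative f (at x) v + frechet_derivative g (at x) v)) (at x)"
      if "x \<in> S" for x
      using Suc.prems that
      by (intro has_derivative_add) (auto simp: frechet_derivative_works)
  qed (use Suc in auto)
qed

lemma Ck_on_bilinear:
  assumes bl: "bounded_bilinear B" and "open S" "Ck_on k S f" "Ck_on k S g"
  shows "Ck_on k S (\<lambda>x. B (f x) (g x))"
  using assms(3,4)
proof (induction k arbitrary: f g)
  case 0
  then show ?case by (auto intro: bounded_bilinear.continuous_on[OF bl])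
next
  case (Suc k)
  show ?case
  proof (rule Ck_on_SucI[OF assms(2)])
    show "((\<lambda>x. B (f x) (g x)) has_derivative (\<lambda>v. B (f x) (frechet_derivative g (at x) v)
        + B (frechet_derivative f (at x) v) (g x))) (at x)"
      if "x \<in> S" for x
      using Suc.prems that
      by (intro bounded_bilinear.FDERIV[OF bl]) (auto simp: frechet_derivative_works)
    show "Ck_on k S (\<lambda>x. B (f x) (frechet_derivative g (at x) v)
        + B (frechet_derivative f (at x) v) (g x))" for v
      using Suc.prems Ck_on_SucD[OF Suc.prems(1)] Ck_on_SucD[OF Suc.prems(2)]
      by (intro Ck_on_add[OF \<open>open S\<close>] Suc.IH) auto
  qed
qed

lemma Ck_on_sum:
  assumes "open S" "\<And>i. i \<in> I \<Longrightarrow> Ck_on k S (f i)"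
  shows "Ck_on k S (\<lambda>x. \<Sum>i\<in>I. f i x)"
proof (cases "finite I")
  case True
  then show ?thesis using assms(2)
    by (induction I) (auto intro: Ck_on_add[OF assms(1)] Ck_on_const)
qed (simp add: Ck_on_const)

text \<open>
  The derivative of the outer map is expanded in the standard basis, so that the chain rule only
  mentions directional derivatives in constant directions, on which \<open>Ck_on\<close> recurses.
\<close>

lemma Ck_on_compose:
  fixes f :: "'a::euclidean_space \<Rightarrow> 'b::euclidean_space"
    and g :: "'b \<Rightarrow> 'c::real_normed_vector"
  assumes "open S" "Ck_on k T g" "Ck_on k S f" "f ` S \<subseteq> T"
  shows "Ck_on k S (\<lambda>x. g (f x))"
  using assms(2,3)
proof (induction k arbitrary: g)
  case 0
  then show ?case using assms(4) by (auto intro: continuous_on_compose2)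
next
  case (Suc k)
  let ?f' = "\<lambda>x. frechet_derivative f (at x)" and ?g' = "\<lambda>y. frechet_derivative g (at y)"
  have df: "(f has_derivative ?f' x) (at x)" if "x \<in> S" for x
    using Suc.prems that by (auto simp: frechet_derivative_works)
  have dg: "(g has_derivative ?g' (f x)) (at (f x))" if "x \<in> S" for x
    using Suc.prems that assms(4) by (auto simp: frechet_derivative_works)
  show ?case
  proof (rule Ck_on_SucI[OF assms(1)])
    fix x assume "x \<in> S"
    have lin: "linear (?g' (f x))" using dg[OF \<open>x \<in> S\<close>] has_derivative_linear by blast
    have "?g' (f x) (?f' x v) = (\<Sum>b\<in>Basis. (?f' x v \<bullet> b) *\<^sub>R ?g' (f x) b)" for v
    proof -
      have "?g' (f x) (?f' x v) = ?g' (f x) (\<Sum>b\<in>Basis. (?f' x v \<bullet> b) *\<^sub>R b)"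
        by (simp add: euclidean_representation)
      then show ?thesis by (simp add: linear_sum[OF lin] linear_scale[OF lin])
    qed
    then show "((\<lambda>x. g (f x)) has_derivative
        (\<lambda>v. \<Sum>b\<in>Basis. (?f' x v \<bullet> b) *\<^sub>R ?g' (f x) b)) (at x)"
      using has_derivative_compose[OF df[OF \<open>x \<in> S\<close>] dg[OF \<open>x \<in> S\<close>]] by simp
  next
    fix v
    have "Ck_on k S (\<lambda>x. ?f' x v \<bullet> b)" for b
      using Suc.prems(2) by (intro Ck_on_bounded_linear[OF bounded_linear_inner_left assms(1)]) simp
    moreover have "Ck_on k S (\<lambda>x. ?g' (f x) b)" for b
      using Suc.prems(1) by (intro Suc.IH[OF _ Ck_on_SucD[OF Suc.prems(2)]]) simp
    ultimately show "Ck_on k S (\<lambda>x. \<Sum>b\<in>Basis. (?f' x v \<bullet> b) *\<^sub>R ?g' (f x) b)"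
      by (intro Ck_on_sum Ck_on_bilinear[OF bounded_bilinear_scaleR] assms(1))
  qed
qed

text \<open>
  A bootstrapping principle: a solution of a smooth autonomous total differential equation is
  smooth. It covers reciprocals, square roots and local inverses alike.
\<close>

lemma smooth_on_autonomous:
  fixes g :: "'a::euclidean_space \<Rightarrow> 'b::euclidean_space"
  assumes "open V" and der: "\<And>y. y \<in> V \<Longrightarrow> (g has_derivative (\<lambda>v. F v (g y))) (at y)"
    and F: "\<And>v. smooth_on U (F v)" and "g ` V \<subseteq> U"
  shows "smooth_on V g"
proof -
  have "Ck_on k V g" for k
  proof (induction k)
    case 0
    then show ?case
      using der has_derivative_continuous by (fastforce intro: continuous_at_imp_continuous_on)
  next
    case (Suc k)
    show ?case
      using F by (intro Ck_on_SucI[OF \<open>open V\<close> der] Ck_on_compose[OF \<open>open V\<close> _ Suc \<open>g ` V \<subseteq> U\<close>])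
        (auto simp: smooth_on_def)
  qed
  then show ?thesis using \<open>open V\<close> by (simp add: smooth_on_def)
qed

lemma smooth_on_cong: "smooth_on S f \<Longrightarrow> (\<And>x. x \<in> S \<Longrightarrow> f x = g x) \<Longrightarrow> smooth_on S g"
  unfolding smooth_on_def using Ck_on_cong by blast

lemma smooth_on_subset: "smooth_on S f \<Longrightarrow> open T \<Longrightarrow> T \<subseteq> S \<Longrightarrow> smooth_on T f"
  unfolding smooth_on_def using Ck_on_subset by blast

lemma smooth_on_const: "open S \<Longrightarrow> smooth_on S (\<lambda>x. c)"
  by (simp add: smooth_on_def Ck_on_const)

lemma smooth_on_id: "open S \<Longrightarrow> smooth_on S (\<lambda>x. x)"
  by (simp add: smooth_on_def Ck_on_id)

lemma smooth_on_bounded_linear: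
  "bounded_linear L \<Longrightarrow> smooth_on S f \<Longrightarrow> smooth_on S (\<lambda>x. L (f x))"
  by (simp add: smooth_on_def Ck_on_bounded_linear)

lemma smooth_on_add: "smooth_on S f \<Longrightarrow> smooth_on S g \<Longrightarrow> smooth_on S (\<lambda>x. f x + g x)"
  by (simp add: smooth_on_def Ck_on_add)

lemma smooth_on_bilinear:
  "bounded_bilinear B \<Longrightarrow> smooth_on S f \<Longrightarrow> smooth_on S g \<Longrightarrow> smooth_on S (\<lambda>x. B (f x) (g x))"
  by (simp add: smooth_on_def Ck_on_bilinear)

lemmas smooth_on_mult = smooth_on_bilinear[OF bounded_bilinear_mult]
lemmas smooth_on_scaleR = smooth_on_bilinear[OF bounded_bilinear_scaleR]

lemma smooth_on_cmult:
  fixes f :: "_ \<Rightarrow> real"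
  shows "smooth_on S f \<Longrightarrow> smooth_on S (\<lambda>x. c * f x)"
  by (rule smooth_on_bounded_linear[OF bounded_linear_mult_right])

lemma smooth_on_minus:
  "smooth_on S f \<Longrightarrow> smooth_on S (\<lambda>x. - f x)"
  using smooth_on_bounded_linear[OF bounded_linear_minus[OF bounded_linear_ident]] .

lemma smooth_on_diff: "smooth_on S f \<Longrightarrow> smooth_on S g \<Longrightarrow> smooth_on S (\<lambda>x. f x - g x)"
  using smooth_on_add[OF _ smooth_on_minus[of S g]] by simp

lemma smooth_on_nth:
  fixes f :: "_ \<Rightarrow> real^'n"
  shows "smooth_on S f \<Longrightarrow> smooth_on S (\<lambda>x. f x $ i)"
  using smooth_on_bounded_linear[OF bounded_linear_vec_nth] .

lemma smooth_on_compose: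
  fixes f :: "'a::euclidean_space \<Rightarrow> 'b::euclidean_space"
  shows "smooth_on T g \<Longrightarrow> smooth_on S f \<Longrightarrow> f ` S \<subseteq> T \<Longrightarrow> smooth_on S (\<lambda>x. g (f x))"
  unfolding smooth_on_def using Ck_on_compose by blast

lemma vector_2_eq: "(vector [a, b] :: real^2) = a *\<^sub>R axis 1 1 + b *\<^sub>R axis 2 1"
  by (simp add: vec_eq_iff forall_2 axis_def)

lemma smooth_on_vector_2:
  "smooth_on S f \<Longrightarrow> smooth_on S g \<Longrightarrow> smooth_on S (\<lambda>x. vector [f x, g x] :: real^2)"
  unfolding vector_2_eq
  by (intro smooth_on_add smooth_on_scaleR smooth_on_const) (auto simp: smooth_on_def)

lemma smooth_on_has_derivative:
  "smooth_on S f \<Longrightarrow> x \<in> S \<Longrightarrow> (f has_derivative frechet_derivative f (at x)) (at x)"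
  unfolding smooth_on_def frechet_derivative_works[symmetric] by (metis Ck_on.simps(2))

lemma smooth_on_frechet_derivative:
  "smooth_on S f \<Longrightarrow> smooth_on S (\<lambda>x. frechet_derivative f (at x) v)"
  unfolding smooth_on_def by (metis Ck_on.simps(2))

lemma smooth_on_continuous: "smooth_on S f \<Longrightarrow> continuous_on S f"
  unfolding smooth_on_def by (metis Ck_on.simps(1))

lemma smooth_on_inverse:
  fixes f :: "'a::euclidean_space \<Rightarrow> real"
  assumes "smooth_on S f" "\<And>x. x \<in> S \<Longrightarrow> f x \<noteq> 0"
  shows "smooth_on S (\<lambda>x. inverse (f x))"
proof (rule smooth_on_compose[OF _ assms(1)])
  show "smooth_on (- {0::real}) inverse"
  proof (rule smooth_on_autonomous[where F="\<lambda>v y. - (y * v * y)" and U=UNIV])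
    show "smooth_on UNIV (\<lambda>y::real. - (y * v * y))" for v
      by (intro smooth_on_minus smooth_on_mult smooth_on_id smooth_on_const) auto
  qed (use has_derivative_inverse' in auto)
qed (use assms(2) in auto)

lemma smooth_on_divide:
  fixes f g :: "'a::euclidean_space \<Rightarrow> real"
  assumes "smooth_on S f" "smooth_on S g" "\<And>x. x \<in> S \<Longrightarrow> g x \<noteq> 0"
  shows "smooth_on S (\<lambda>x. f x / g x)"
  unfolding divide_inverse by (intro smooth_on_mult smooth_on_inverse assms)

lemma smooth_on_sqrt:
  fixes f :: "'a::euclidean_space \<Rightarrow> real"
  assumes "smooth_on S f" "\<And>x. x \<in> S \<Longrightarrow> f x > 0"
  shows "smooth_on S (\<lambda>x. sqrt (f x))"
proof (rule smooth_on_compose[OF _ assms(1)])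
  show "smooth_on {0<..} sqrt"
  proof (rule smooth_on_autonomous[where F="\<lambda>v y. v / (2 * y)" and U="{0<..}"])
    show "(sqrt has_derivative (\<lambda>v. v / (2 * sqrt y))) (at y)" if "y \<in> {0<..}" for y
      using that by (auto intro!: derivative_eq_intros ext simp: field_simps)
    show "smooth_on {0<..} (\<lambda>y::real. v / (2 * y))" for v
      by (intro smooth_on_divide smooth_on_cmult smooth_on_id smooth_on_const) auto
  qed auto
qed (use assms(2) in auto)

lemma axis_2_nth [simp]:
  "axis 1 a $ (1::2) = a" "axis 1 a $ (2::2) = 0" "axis 2 a $ (1::2) = 0" "axis 2 a $ (2::2) = a"
  by (simp_all add: axis_def)

lemma frechet_derivative_eqI:
  "(f has_derivative f') (at x) \<Longrightarrow> frechet_derivative f (at x) v = f' v"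
  using frechet_derivative_at[of f f' x] by simp

lemma frechet_derivative_vector_2:
  assumes "smooth_on S a" "smooth_on S b" "x \<in> S"
  shows "frechet_derivative (\<lambda>x. vector [a x, b x] :: real^2) (at x) v
    = vector [frechet_derivative a (at x) v, frechet_derivative b (at x) v]"
proof -
  have "((\<lambda>x. vector [a x, b x] :: real^2) has_derivative
      (\<lambda>v. vector [frechet_derivative a (at x) v, frechet_derivative b (at x) v])) (at x)"
    unfolding vector_2_eq
    by (intro has_derivative_add has_derivative_scaleR_left
        smooth_on_has_derivative[OF assms(1,3)] smooth_on_has_derivative[OF assms(2,3)])
  then show ?thesis by (rule frechet_derivative_eqI)
qed

lemma frechet_derivative_mult_zero:
  fixes a b :: "'a::euclidean_space \<Rightarrow> real"
  assumes "smooth_on S a" "smooth_on S b" "x \<in> S" "a x = 0"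
  shows "frechet_derivative (\<lambda>x. a x * b x) (at x) v = frechet_derivative a (at x) v * b x"
proof -
  have "((\<lambda>x. a x * b x) has_derivative (\<lambda>v. frechet_derivative a (at x) v * b x)) (at x)"
    using has_derivative_mult[OF smooth_on_has_derivative[OF assms(1,3)]
        smooth_on_has_derivative[OF assms(2,3)]] assms(4) by simp
  then show ?thesis by (rule frechet_derivative_eqI)
qed

lemma vector_2_eq_0_iff: "(vector [a, b] :: real^2) = 0 \<longleftrightarrow> a = 0 \<and> b = 0"
  by (simp add: vec_eq_iff forall_2)

section \<open>Second derivatives\<close>

text \<open>
  The second difference over the parallelogram spanned by \<open>t a\<close> and \<open>t b\<close> is symmetric in \<open>a\<close> and
  \<open>b\<close>; by the mean value theorem along \<open>a\<close> it is \<open>t\<^sup>2\<close> times the derivative of \<open>\<partial>\<^sub>a f\<close> in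
  direction \<open>b\<close>, up to an arbitrarily small multiple of \<open>t\<^sup>2\<close>.
\<close>

lemma second_difference:
  fixes f :: "'a::real_normed_vector \<Rightarrow> real"
  assumes "open U" "0 \<in> U"
    and f: "\<And>x. x \<in> U \<Longrightarrow> (f has_derivative f' x) (at x)"
    and f': "((\<lambda>x. f' x a) has_derivative l) (at 0)" and "e > 0"
  shows "\<forall>\<^sub>F t in at_right 0. \<bar>f (t *\<^sub>R a + t *\<^sub>R b) - f (t *\<^sub>R a) - f (t *\<^sub>R b) + f 0 - t\<^sup>2 * l b\<bar>
      \<le> e * (2 * norm a + norm b) * t\<^sup>2"
proof -
  obtain d where "d > 0" and d: "\<And>x. norm x < d \<Longrightarrow> \<bar>f' x a - f' 0 a - l x\<bar> \<le> e * norm x"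
    using f' \<open>e > 0\<close> unfolding has_derivative_at_alt by auto
  obtain r where "r > 0" and r: "ball 0 r \<subseteq> U" using assms openE by blast
  \<comment> \<open>For \<open>t < c\<close> the whole parallelogram lies in the balls of radius \<open>d\<close> and \<open>r\<close>.\<close>
  define c where "c = min d r / (norm a + norm b + 1)"
  have "c > 0" using \<open>d > 0\<close> \<open>r > 0\<close> by (simp add: c_def add_pos_nonneg add_nonneg_pos)
  have l: "linear l" using f' has_derivative_linear by blast
  show ?thesis
    unfolding eventually_at_right_field
  proof (intro exI[of _ c] conjI impI allI \<open>c > 0\<close>)
    fix t :: real assume "0 < t" "t < c"
    have small: "norm (s *\<^sub>R a + z *\<^sub>R b) < min d r" if "0 \<le> s" "s \<le> t" "0 \<le> z" "z \<le> t" for s z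
    proof -
      have "norm (s *\<^sub>R a + z *\<^sub>R b) \<le> s * norm a + z * norm b"
        using norm_triangle_ineq[of "s *\<^sub>R a" "z *\<^sub>R b"] that by simp
      also have "\<dots> \<le> t * norm a + t * norm b"
        using that by (intro add_mono mult_right_mono) auto
      also have "\<dots> \<le> t * (norm a + norm b + 1)" using \<open>0 < t\<close> by (simp add: algebra_simps)
      also have "\<dots> < c * (norm a + norm b + 1)"
        using \<open>t < c\<close> by (intro mult_strict_right_mono) (auto intro: add_nonneg_pos)
      also have "\<dots> = min d r"
        using add_nonneg_pos[of "norm a + norm b" 1] by (simp add: c_def)
      finally show ?thesis .
    qed
    have inU: "s *\<^sub>R a + z *\<^sub>R b \<in> U" if "0 \<le> s" "s \<le> t" "0 \<le> z" "z \<le> t" for s z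
      using small[OF that] r by auto
    define p where "p = (\<lambda>s. f (s *\<^sub>R a + t *\<^sub>R b) - f (s *\<^sub>R a))"
    have scale: "f' x (h *\<^sub>R a) = f' x a * h" if "x \<in> U" for x h
      using linear_scale[OF has_derivative_linear[OF f[OF that]], of h a] by simp
    have p: "DERIV p s :> f' (s *\<^sub>R a + t *\<^sub>R b) a - f' (s *\<^sub>R a) a" if "0 \<le> s" "s \<le> t" for s
    proof -
      have x: "s *\<^sub>R a + t *\<^sub>R b \<in> U" and y: "s *\<^sub>R a \<in> U"
        using inU[OF that, of t] inU[OF that, of 0] \<open>0 < t\<close> by auto
      have "(p has_derivative (\<lambda>h. f' (s *\<^sub>R a + t *\<^sub>R b) (h *\<^sub>R a) - f' (s *\<^sub>R a) (h *\<^sub>R a))) (at s)"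
        unfolding p_def
        by (intro has_derivative_diff
            has_derivative_compose[where g=f and f="\<lambda>s. s *\<^sub>R a + t *\<^sub>R b", OF _ f[OF x]]
            has_derivative_compose[where g=f and f="\<lambda>s. s *\<^sub>R a", OF _ f[OF y]])
          (auto intro!: derivative_eq_intros)
      then show ?thesis
        unfolding has_field_derivative_def by (simp only: scale[OF x] scale[OF y] left_diff_distrib[symmetric])
    qed
    obtain z where z: "0 < z" "z < t" "p t - p 0 = t * (f' (z *\<^sub>R a + t *\<^sub>R b) a - f' (z *\<^sub>R a) a)"
      using MVT2[OF \<open>0 < t\<close> p] by auto
    let ?x = "z *\<^sub>R a + t *\<^sub>R b" and ?y = "z *\<^sub>R a"
    have "norm ?x \<le> t * norm a + t * norm b"
      using norm_triangle_ineq[of "z *\<^sub>R a" "t *\<^sub>R b"] z mult_right_mono[of z t "norm a"] by auto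
    moreover have "norm ?y \<le> t * norm a" using z by (auto intro: mult_right_mono)
    ultimately have "norm ?x + norm ?y \<le> (2 * norm a + norm b) * t" by (simp add: algebra_simps)
    then have n: "e * (norm ?x + norm ?y) \<le> e * ((2 * norm a + norm b) * t)"
      using \<open>e > 0\<close> by simp
    have "l ?x - l ?y = t * l b" by (simp add: linear_add[OF l] linear_scale[OF l])
    then have "\<bar>f' ?x a - f' ?y a - t * l b\<bar> \<le> e * norm ?x + e * norm ?y"
      using d[of ?x] d[of ?y] small[of z t] small[of z 0] z \<open>0 < t\<close> by (simp add: abs_le_iff)
    also have "\<dots> \<le> e * (2 * norm a + norm b) * t" using n by (simp add: algebra_simps)
    finally have "t * \<bar>f' ?x a - f' ?y a - t * l b\<bar> \<le> t * (e * (2 * norm a + norm b) * t)"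
      using \<open>0 < t\<close> by simp
    moreover have "f (t *\<^sub>R a + t *\<^sub>R b) - f (t *\<^sub>R a) - f (t *\<^sub>R b) + f 0 - t\<^sup>2 * l b
        = t * (f' ?x a - f' ?y a - t * l b)"
      using z(3) by (simp add: p_def power2_eq_square algebra_simps)
    ultimately show "\<bar>f (t *\<^sub>R a + t *\<^sub>R b) - f (t *\<^sub>R a) - f (t *\<^sub>R b) + f 0 - t\<^sup>2 * l b\<bar>
        \<le> e * (2 * norm a + norm b) * t\<^sup>2"
      using \<open>0 < t\<close> by (simp add: abs_mult power2_eq_square mult_ac)
  qed
qed

lemma has_derivative_second_deriv:
  assumes "smooth_on U f" "0 \<in> U"
  shows "((\<lambda>x. frechet_derivative f (at x) v) has_derivative second_deriv f v) (at 0)"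
  unfolding second_deriv_def[abs_def]
  using smooth_on_has_derivative[OF smooth_on_frechet_derivative[OF assms(1)] assms(2)] .

lemma second_deriv_symmetric:
  assumes "smooth_on U f" "0 \<in> U"
  shows "second_deriv f a b = second_deriv f b a"
proof -
  have U: "open U" using assms(1) by (simp add: smooth_on_def)
  note f = smooth_on_has_derivative[OF assms(1)]
  have diff: "\<forall>\<^sub>F t in at_right 0.
      \<bar>f (t *\<^sub>R a + t *\<^sub>R b) - f (t *\<^sub>R a) - f (t *\<^sub>R b) + f 0 - t\<^sup>2 * second_deriv f a b\<bar>
        \<le> e * (2 * norm a + norm b) * t\<^sup>2" if "e > 0" for e a b
    by (rule second_difference[OF U assms(2) f has_derivative_second_deriv[OF assms] that])
  have "\<bar>second_deriv f a b - second_deriv f b a\<bar> \<le> 0 + e" if "e > 0" for e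
  proof -
    define c where "c = 3 * norm a + 3 * norm b + 1"
    have "c > 0" by (simp add: c_def add_nonneg_pos)
    define e' where "e' = e / c"
    have "e' > 0" using that \<open>c > 0\<close> by (simp add: e'_def)
    have "\<forall>\<^sub>F t::real in at_right 0. 0 < t" by (simp add: eventually_at_right_less)
    with diff[OF \<open>e' > 0\<close>, of a b] diff[OF \<open>e' > 0\<close>, of b a]
    have "\<forall>\<^sub>F t::real in at_right 0. \<bar>second_deriv f a b - second_deriv f b a\<bar> \<le> e"
    proof eventually_elim
      case (elim t)
      have "\<bar>t\<^sup>2 * (second_deriv f a b - second_deriv f b a)\<bar>
          \<le> e' * (2 * norm a + norm b) * t\<^sup>2 + e' * (2 * norm b + norm a) * t\<^sup>2"
        using elim(1) elim(2)[unfolded add.commute[of "t *\<^sub>R b" "t *\<^sub>R a"]]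
        unfolding right_diff_distrib by linarith
      also have "\<dots> \<le> t\<^sup>2 * (e' * c)"
        using \<open>e' > 0\<close> elim(3) by (simp add: c_def algebra_simps)
      finally have "t\<^sup>2 * \<bar>second_deriv f a b - second_deriv f b a\<bar> \<le> t\<^sup>2 * (e' * c)"
        by (simp add: abs_mult)
      then show ?case using elim(3) \<open>c > 0\<close> by (simp add: e'_def)
    qed
    then show ?thesis by (simp add: eventually_const_iff trivial_limit_at_right_real)
  qed
  then show ?thesis using field_le_epsilon[of "\<bar>second_deriv f a b - second_deriv f b a\<bar>" 0] by simp
qed

lemma linear_2:
  fixes L :: "real^2 \<Rightarrow> 'b::real_vector"
  assumes "linear L"
  shows "L v = v$1 *\<^sub>R L (axis 1 1) + v$2 *\<^sub>R L (axis 2 1)"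
proof -
  have "v = v$1 *\<^sub>R axis 1 1 + v$2 *\<^sub>R axis 2 1"
    by (simp add: vec_eq_iff forall_2 axis_def)
  then have "L v = L (v$1 *\<^sub>R axis 1 1 + v$2 *\<^sub>R axis 2 1)" by (rule arg_cong)
  then show ?thesis by (simp only: linear_add[OF assms] linear_scale[OF assms])
qed

lemma second_deriv_2:
  assumes "smooth_on U f" "0 \<in> U"
  shows "second_deriv f u v =
    u$1 * (v$1 * second_deriv f (axis 1 1) (axis 1 1) + v$2 * second_deriv f (axis 1 1) (axis 2 1)) +
    u$2 * (v$1 * second_deriv f (axis 2 1) (axis 1 1) + v$2 * second_deriv f (axis 2 1) (axis 2 1))"
proof -
  note d = has_derivative_second_deriv[OF assms]
  have "((\<lambda>x. frechet_derivative f (at x) u) has_derivative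
      (\<lambda>v. u$1 * second_deriv f (axis 1 1) v + u$2 * second_deriv f (axis 2 1) v)) (at 0)"
  proof (rule has_derivative_transform_within_open)
    show "open U" using assms(1) by (simp add: smooth_on_def)
    show "((\<lambda>x. u$1 * frechet_derivative f (at x) (axis 1 1)
        + u$2 * frechet_derivative f (at x) (axis 2 1)) has_derivative
        (\<lambda>v. u$1 * second_deriv f (axis 1 1) v + u$2 * second_deriv f (axis 2 1) v)) (at 0)"
      by (intro has_derivative_add has_derivative_mult_right d)
    show "u$1 * frechet_derivative f (at x) (axis 1 1) + u$2 * frechet_derivative f (at x) (axis 2 1)
        = frechet_derivative f (at x) u" if "x \<in> U" for x
      using linear_2[OF has_derivative_linear[OF smooth_on_has_derivative[OF assms(1) that]], of u]
      by simp
  qed (rule assms(2))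
  from has_derivative_unique[OF d[of u] this]
  have "second_deriv f u v = u$1 * second_deriv f (axis 1 1) v + u$2 * second_deriv f (axis 2 1) v"
    by (rule fun_cong)
  then show ?thesis
    by (simp add: linear_2[OF has_derivative_linear[OF d], of _ v])
qed

section \<open>Smooth local inverses in the plane\<close>

text \<open>
  The inverse function theorem provides a differentiable local inverse \<open>g\<close>. By Cramer's rule its
  derivative is a smooth function of the value of \<open>g\<close>, so the bootstrapping principle applies.
\<close>

lemma smooth_local_inverse:
  fixes f :: "real^2 \<Rightarrow> real^2"
  assumes f: "smooth_on U f" and "x0 \<in> U"
    and inj: "\<And>v. frechet_derivative f (at x0) v = 0 \<Longrightarrow> v = 0"
  obtains U' V g where "open U'" "U' \<subseteq> U" "x0 \<in> U'" "open V" "homeomorphism U' V f g" "smooth_on V g"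
proof -
  define f' where "f' = (\<lambda>x. Blinfun (frechet_derivative f (at x)))"
  have app: "blinfun_apply (f' x) = frechet_derivative f (at x)" if "x \<in> U" for x
    using smooth_on_has_derivative[OF f that]
    by (simp add: f'_def bounded_linear_Blinfun_apply has_derivative_bounded_linear)
  have lin: "linear (frechet_derivative f (at x))" if "x \<in> U" for x
    using smooth_on_has_derivative[OF f that] has_derivative_linear by blast
  have "open U" using f by (simp add: smooth_on_def)
  have der: "(f has_derivative blinfun_apply (f' x)) (at x)" if "x \<in> U" for x
    using smooth_on_has_derivative[OF f that] app[OF that] by simp
  have cont: "continuous_on U f'"
  proof (rule continuous_on_blinfun_componentwise)
    show "continuous_on U (\<lambda>x. blinfun_apply (f' x) i)" for i
      using smooth_on_continuous[OF smooth_on_frechet_derivative[OF f]] app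
      by (simp cong: continuous_on_cong)
  qed
  obtain h where h: "linear h" "h \<circ> frechet_derivative f (at x0) = id"
    using linear_injective_left_inverse[OF lin[OF \<open>x0 \<in> U\<close>]] inj
      linear_injective_0[OF lin[OF \<open>x0 \<in> U\<close>]] by blast
  have "Blinfun h o\<^sub>L f' x0 = id_blinfun"
    using h app[OF \<open>x0 \<in> U\<close>]
    by (intro blinfun_eqI)
      (simp add: bounded_linear_Blinfun_apply linear_conv_bounded_linear[symmetric] fun_eq_iff)
  from inverse_function_theorem[OF \<open>open U\<close> der cont \<open>x0 \<in> U\<close> this]
  obtain U' V g g' where *: "open U'" "U' \<subseteq> U" "x0 \<in> U'" "open V" "homeomorphism U' V f g"
    and g: "\<And>y. y \<in> V \<Longrightarrow> (g has_derivative (g' y)) (at y)"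
    and g': "\<And>y. y \<in> V \<Longrightarrow> g' y = inv (blinfun_apply (f'(g y)))"
    and bij: "\<And>y. y \<in> V \<Longrightarrow> bij (blinfun_apply (f'(g y)))"
    by metis
  define a b where "a = (\<lambda>x. frechet_derivative f (at x) (axis 1 1))"
    and "b = (\<lambda>x. frechet_derivative f (at x) (axis 2 1))"
  define D where "D = (\<lambda>x. a x $ 1 * b x $ 2 - a x $ 2 * b x $ 1)"
  define F :: "real^2 \<Rightarrow> real^2 \<Rightarrow> real^2" where "F = (\<lambda>v x. vector [(b x $ 2 * v$1 - b x $ 1 * v$2) / D x,
    (a x $ 1 * v$2 - a x $ 2 * v$1) / D x] :: real^2)"
  have gV: "g y \<in> U'" if "y \<in> V" for y using *(5) that by (auto simp: homeomorphism_def)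
  have ab: "frechet_derivative f (at x) w = w$1 *\<^sub>R a x + w$2 *\<^sub>R b x" if "x \<in> U" for x w
    unfolding a_def b_def by (rule linear_2[OF lin[OF that]])
  have Fr: "frechet_derivative f (at x) (F v x) = v" if "x \<in> U" "D x \<noteq> 0" for x v
  proof -
    have "(b x $ 2 * v$1 - b x $ 1 * v$2) * a x $ i + (a x $ 1 * v$2 - a x $ 2 * v$1) * b x $ i
        = v $ i * D x" for i
      using exhaust_2[of i] by (auto simp: D_def algebra_simps)
    then show ?thesis
      using that(2) unfolding ab[OF that(1)]
      by (simp add: F_def vec_eq_iff times_divide_eq_left add_divide_distrib[symmetric])
  qed
  have D: "D x \<noteq> 0" if "x \<in> U'" for x
  proof
    assume "D x = 0"
    have "f x \<in> V" "g (f x) = x" using *(5) that by (auto simp: homeomorphism_def)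
    then have inj: "inj (frechet_derivative f (at x))"
      using bij[of "f x"] app[of x] that *(2) by (auto simp: bij_def)
    have "x \<in> U" using that *(2) by blast
    have 0: "v = 0" if "frechet_derivative f (at x) v = 0" for v
      using inj linear_injective_0[OF lin[OF \<open>x \<in> U\<close>]] that by blast
    have "frechet_derivative f (at x) (vector [b x $ i, - a x $ i]) = 0" for i :: 2
      using \<open>D x = 0\<close> exhaust_2[of i] unfolding ab[OF \<open>x \<in> U\<close>]
      by (auto simp: vec_eq_iff forall_2 D_def algebra_simps)
    then have "a x $ i = 0" for i :: 2 using 0[of "vector [b x $ i, - a x $ i]"]
      by (simp add: vec_eq_iff forall_2)
    then have "a x = 0" by (simp add: vec_eq_iff)
    then have "axis 1 1 = (0::real^2)" using 0[of "axis 1 1"] by (simp only: a_def)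
    then show False by (simp add: axis_eq_0_iff)
  qed
  have "smooth_on V g"
  proof (rule smooth_on_autonomous[OF \<open>open V\<close>])
    show "(g has_derivative (\<lambda>v. F v (g y))) (at y)" if "y \<in> V" for y
    proof -
      have "g y \<in> U" using gV[OF that] *(2) by blast
      have "g' y v = F v (g y)" for v
        unfolding g'[OF that] app[OF \<open>g y \<in> U\<close>]
        using bij[OF that] Fr[OF \<open>g y \<in> U\<close> D[OF gV[OF that]]] app[OF \<open>g y \<in> U\<close>]
        by (metis bij_inv_eq_iff)
      then show ?thesis using g[OF that] by (metis ext)
    qed
    show "smooth_on U' (F v)" for v
      using D unfolding F_def D_def a_def b_def
      by (intro smooth_on_vector_2 smooth_on_divide smooth_on_diff smooth_on_mult
          smooth_on_const smooth_on_nth smooth_on_frechet_derivative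
          smooth_on_subset[OF f *(1,2)]) (auto simp: *(1))
  qed (use gV in auto)
  then show ?thesis using that * by blast
qed

lemma diffeo_germI:
  assumes "smooth_on U \<phi>" "0 \<in> U" "\<phi> 0 = 0"
    and "\<And>v. frechet_derivative \<phi> (at 0) v = 0 \<Longrightarrow> v = 0"
  shows "diffeo_germ \<phi>"
proof -
  obtain U' V g where *: "open U'" "U' \<subseteq> U" "0 \<in> U'" "open V" "homeomorphism U' V \<phi> g" "smooth_on V g"
    using smooth_local_inverse[OF assms(1,2,4)] by metis
  have "\<phi> ` U' = V \<and> g ` V = U' \<and> (\<forall>x\<in>U'. g (\<phi> x) = x) \<and> (\<forall>y\<in>V. \<phi> (g y) = y)"
    using *(5) by (simp add: homeomorphism_def)
  then show ?thesis
    unfolding diffeo_germ_def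
    using assms(3) smooth_on_subset[OF assms(1) *(1,2)] *(3,6) by blast
qed

lemma diffeo_germ_deriv_inj:
  assumes "diffeo_germ \<phi>"
  obtains U where "0 \<in> U" "smooth_on U \<phi>" "\<And>v. frechet_derivative \<phi> (at 0) v = 0 \<Longrightarrow> v = 0"
proof -
  obtain U V \<psi> where *: "0 \<in> U" "smooth_on U \<phi>" "smooth_on V \<psi>" "\<phi> ` U = V"
    "\<And>x. x \<in> U \<Longrightarrow> \<psi> (\<phi> x) = x" "\<phi> 0 = 0"
    using assms unfolding diffeo_germ_def by metis
  have "open U" "0 \<in> V" using * by (auto simp: smooth_on_def)
  have d: "((\<lambda>x. \<psi> (\<phi> x)) has_derivative
      (\<lambda>v. frechet_derivative \<psi> (at 0) (frechet_derivative \<phi> (at 0) v))) (at 0)"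
    using has_derivative_compose[OF smooth_on_has_derivative[OF *(2,1)], of \<psi>]
      smooth_on_has_derivative[OF *(3) \<open>0 \<in> V\<close>] *(6) by simp
  have "((\<lambda>x. x) has_derivative
      (\<lambda>v. frechet_derivative \<psi> (at 0) (frechet_derivative \<phi> (at 0) v))) (at 0)"
    by (rule has_derivative_transform_within_open[OF d \<open>open U\<close> *(1)]) (rule *(5))
  from has_derivative_unique[OF this has_derivative_ident]
  have inv: "frechet_derivative \<psi> (at 0) (frechet_derivative \<phi> (at 0) v) = v" for v by (rule fun_cong)
  have "linear (frechet_derivative \<psi> (at 0))"
    using smooth_on_has_derivative[OF *(3) \<open>0 \<in> V\<close>] has_derivative_linear by blast
  then have "v = 0" if "frechet_derivative \<phi> (at 0) v = 0" for v
    using inv[of v] that by (simp add: linear_0)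
  then show ?thesis using that * by blast
qed

section \<open>Smooth dependence of integrals on parameters\<close>

text \<open>
  Differentiation under the integral sign in a direction \<open>v\<close> leads to the same kind of integral, for
  the directional derivative of the integrand in direction \<open>(v, 0)\<close>.
\<close>

lemma Ck_on_integral:
  fixes F :: "'a::euclidean_space \<times> real \<Rightarrow> 'b::euclidean_space"
  assumes "open S" "convex S" "open T" "{0..1} \<subseteq> T" "Ck_on k (S \<times> T) F"
  shows "Ck_on k S (\<lambda>x. integral {0..1} (\<lambda>t. F (x, t)))"
  using assms(5)
proof (induction k arbitrary: F)
  case 0
  then have "continuous_on (S \<times> cbox 0 1) (\<lambda>(x, t). F (x, t))"
    using assms(4) by (auto intro: continuous_on_subset)
  from integral_continuous_on_param[OF this] show ?case by simp
next
  case (Suc k)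
  let ?D = "\<lambda>p. frechet_derivative F (at p)"
  define F' where "F' = (\<lambda>x t. Blinfun (\<lambda>v. ?D (x, t) (v, 0)))"
  have dF: "(F has_derivative ?D (x, t)) (at (x, t))" if "x \<in> S" "t \<in> {0..1}" for x t
    using Suc.prems that assms(4) by (auto simp: frechet_derivative_works)
  have dx: "((\<lambda>x. F (x, t)) has_derivative (\<lambda>v. ?D (x, t) (v, 0))) (at x)"
    if "x \<in> S" "t \<in> {0..1}" for x t
    by (rule has_derivative_compose[where g=F and f="\<lambda>x. (x, t)", OF _ dF[OF that]])
      (auto intro!: derivative_eq_intros)
  have app: "blinfun_apply (F' x t) = (\<lambda>v. ?D (x, t) (v, 0))" if "x \<in> S" "t \<in> {0..1}" for x t
    unfolding F'_def
    by (rule bounded_linear_Blinfun_apply[OF has_derivative_bounded_linear[OF dx[OF that]]])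
  have cont_D: "continuous_on (S \<times> {0..1}) (\<lambda>p. ?D p v)" for v
  proof (rule continuous_on_subset[OF Ck_on_continuous])
    show "Ck_on k (S \<times> T) (\<lambda>p. ?D p v)" using Suc.prems unfolding Ck_on.simps by blast
  qed (use assms(4) in auto)
  have cont_F': "continuous_on (S \<times> cbox 0 1) (\<lambda>(x, t). F' x t)"
  proof (rule continuous_on_blinfun_componentwise)
    show "continuous_on (S \<times> cbox 0 1) (\<lambda>p. blinfun_apply (case p of (x, t) \<Rightarrow> F' x t) i)" for i
      unfolding cbox_interval
      by (rule continuous_on_eq[OF cont_D[of "(i, 0)"]]) (auto simp: app)
  qed
  show ?case
  proof (rule Ck_on_SucI[OF \<open>open S\<close>])
    fix x assume "x \<in> S"
    have int: "F' x integrable_on cbox 0 1"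
    proof (rule integrable_continuous)
      have "continuous_on (cbox 0 1) (\<lambda>t. case (x, t) of (x, t) \<Rightarrow> F' x t)"
        by (rule continuous_on_compose2[OF cont_F'])
          (use \<open>x \<in> S\<close> in \<open>auto intro!: continuous_intros\<close>)
      then show "continuous_on (cbox 0 1) (F' x)" by simp
    qed
    have "((\<lambda>x. integral (cbox 0 1) (\<lambda>t. F (x, t))) has_derivative
        blinfun_apply (integral (cbox 0 1) (F' x))) (at x within S)"
    proof (rule leibniz_rule[OF _ _ cont_F' \<open>x \<in> S\<close> \<open>convex S\<close>])
      show "((\<lambda>x. F (x, t)) has_derivative blinfun_apply (F' x t)) (at x within S)"
        if "x \<in> S" "t \<in> cbox 0 1" for x t
        using dx[of x t] app[of x t] that by (simp add: has_derivative_at_withinI)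
      show "(\<lambda>t. F (x, t)) integrable_on cbox 0 1" if "x \<in> S" for x
      proof -
        have "continuous_on (S \<times> {0..1}) F"
          using assms(4)
          by (intro continuous_on_subset[OF Ck_on_continuous[OF Suc.prems]]) auto
        then have "continuous_on (cbox 0 1) (\<lambda>t. F (x, t))"
          by (rule continuous_on_compose2) (use that in \<open>auto intro!: continuous_intros\<close>)
        then show ?thesis by (rule integrable_continuous)
      qed
    qed
    moreover have "blinfun_apply (integral (cbox 0 1) (F' x))
        = (\<lambda>v. integral {0..1} (\<lambda>t. ?D (x, t) (v, 0)))"
    proof
      fix v
      have "blinfun_apply (integral (cbox 0 1) (F' x)) v
          = integral {0..1} (\<lambda>t. blinfun_apply (F' x t) v)"
        using blinfun_apply_integral[OF int] by simp
      also have "\<dots> = integral {0..1} (\<lambda>t. ?D (x, t) (v, 0))"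
        by (rule integral_cong) (simp add: app[OF \<open>x \<in> S\<close>])
      finally show "blinfun_apply (integral (cbox 0 1) (F' x)) v = \<dots>" .
    qed
    ultimately show "((\<lambda>x. integral {0..1} (\<lambda>t. F (x, t))) has_derivative
        (\<lambda>v. integral {0..1} (\<lambda>t. ?D (x, t) (v, 0)))) (at x)"
      using \<open>x \<in> S\<close> by (simp add: at_within_open[OF _ \<open>open S\<close>])
  next
    show "Ck_on k S (\<lambda>x. integral {0..1} (\<lambda>t. ?D (x, t) (v, 0)))" for v
      using Suc.prems by (intro Suc.IH[of "\<lambda>p. ?D p (v, 0)"]) simp
  qed
qed

lemma smooth_on_integral:
  fixes F :: "'a::euclidean_space \<times> real \<Rightarrow> 'b::euclidean_space"
  assumes "open S" "convex S" "open T" "{0..1} \<subseteq> T" "smooth_on (S \<times> T) F"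
  shows "smooth_on S (\<lambda>x. integral {0..1} (\<lambda>t. F (x, t)))"
  using assms Ck_on_integral unfolding smooth_on_def by blast

section \<open>Fold singularities\<close>

text \<open>
  A germ \<open>(p1, p2)\<close> of corank one whose differential at the origin has kernel spanned by
  \<open>u = (1, \<alpha>)\<close> and image the first axis. Whether it is a fold, and whether its contour then has
  zero curvature, turns out to depend only on \<open>\<alpha>\<close> and on the second order part of \<open>p2\<close>.
\<close>

locale corank_one_germ =
  fixes U :: "(real^2) set" and p1 p2 :: "real^2 \<Rightarrow> real" and \<alpha> :: real
  assumes smooth1: "smooth_on U p1" and smooth2: "smooth_on U p2" and zero: "0 \<in> U"
    and p1_0: "p1 0 = 0" and p2_0: "p2 0 = 0"
    and dp1_0: "\<And>v. frechet_derivative p1 (at 0) v = v$2 - \<alpha> * v$1"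
    and dp2_0: "\<And>v. frechet_derivative p2 (at 0) v = 0"
begin

definition P :: "real^2 \<Rightarrow> real^2" where "P x = vector [p1 x, p2 x]"

definition u :: "real^2" where "u = vector [1, \<alpha>]"

abbreviation pd :: "(real^2 \<Rightarrow> real) \<Rightarrow> 2 \<Rightarrow> real^2 \<Rightarrow> real" where
  "pd f i x \<equiv> frechet_derivative f (at x) (axis i 1)"

definition D :: "real^2 \<Rightarrow> real" where
  "D x = pd p1 1 x * pd p2 2 x - pd p1 2 x * pd p2 1 x"

lemma open_U: "open U"
  using smooth1 by (simp add: smooth_on_def)

lemma frechet_derivative_2:
  assumes "smooth_on S f" "x \<in> S"
  shows "frechet_derivative f (at x) v = v$1 * pd f 1 x + v$2 * pd f 2 x"
  using linear_2[OF has_derivative_linear[OF smooth_on_has_derivative[OF assms]], of v] by simp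

lemma smooth_P: "smooth_on U P"
  unfolding P_def[abs_def] by (intro smooth_on_vector_2 smooth1 smooth2)

lemma dP: "x \<in> U \<Longrightarrow> frechet_derivative P (at x) v
    = vector [frechet_derivative p1 (at x) v, frechet_derivative p2 (at x) v]"
  unfolding P_def[abs_def] by (rule frechet_derivative_vector_2[OF smooth1 smooth2])

lemma P_0: "P 0 = 0"
  by (simp add: P_def p1_0 p2_0 vector_2_eq_0_iff)

lemma det_jacobian_P: "x \<in> U \<Longrightarrow> det (jacobian P (at x)) = D x"
  by (simp add: det_2 jacobian_def matrix_def dP D_def)

lemma singular_set_P: "W \<subseteq> U \<Longrightarrow> singular_set W P = {x \<in> W. D x = 0}"
  using det_jacobian_P by (auto simp: singular_set_def)

lemma smooth_pd: "smooth_on U (pd p1 i)" "smooth_on U (pd p2 i)"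
  using smooth_on_frechet_derivative smooth1 smooth2 by blast+

lemma smooth_D: "smooth_on U D"
  unfolding D_def[abs_def] by (intro smooth_on_diff smooth_on_mult smooth_pd)

lemma D_0: "D 0 = 0"
  by (simp add: D_def dp2_0)

text \<open>
  At the origin the derivative of the Jacobian determinant only sees the second order part of \<open>p2\<close>,
  because the first derivatives of \<open>p2\<close> vanish there.
\<close>

lemma dD_0: "frechet_derivative D (at 0) v = - second_deriv p2 u v"
proof -
  note d = smooth_on_has_derivative[OF smooth_pd(1) zero]
    smooth_on_has_derivative[OF smooth_pd(2) zero]
  have "(D has_derivative (\<lambda>v. (pd p1 1 0 * frechet_derivative (pd p2 2) (at 0) v
        + frechet_derivative (pd p1 1) (at 0) v * pd p2 2 0)
      - (pd p1 2 0 * frechet_derivative (pd p2 1) (at 0) v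
        + frechet_derivative (pd p1 2) (at 0) v * pd p2 1 0))) (at 0)"
    unfolding D_def[abs_def]
    by (intro has_derivative_diff has_derivative_mult d)
  then have "frechet_derivative D (at 0) v = (pd p1 1 0 * frechet_derivative (pd p2 2) (at 0) v
        + frechet_derivative (pd p1 1) (at 0) v * pd p2 2 0)
      - (pd p1 2 0 * frechet_derivative (pd p2 1) (at 0) v
        + frechet_derivative (pd p1 2) (at 0) v * pd p2 1 0)"
    by (rule frechet_derivative_eqI)
  moreover have "second_deriv p2 u v = second_deriv p2 (axis 1 1) v + \<alpha> * second_deriv p2 (axis 2 1) v"
    unfolding second_deriv_2[OF smooth2 zero, of u v]
      second_deriv_2[OF smooth2 zero, of "axis 1 1" v] second_deriv_2[OF smooth2 zero, of "axis 2 1" v]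
    by (simp add: u_def algebra_simps)
  ultimately show ?thesis
    by (simp add: dp1_0 dp2_0 axis_def second_deriv_def)
qed

text \<open>
  Differentiating \<open>\<psi> \<circ> P = (\<phi>\<^sub>1, \<phi>\<^sub>2\<^sup>2)\<close> once at the origin shows that the second component of \<open>\<psi>\<close> has
  zero derivative along the image of \<open>dP\<close>; differentiating it twice along the kernel direction
  \<open>u\<close> then gives \<open>\<partial>\<^sub>2\<psi>\<^sub>2 \<cdot> p2''(u, u) = 2 (d\<phi>\<^sub>2 u)\<^sup>2\<close>. Since \<open>d\<phi>\<^sub>1 u = 0\<close> and \<open>d\<phi>\<close> is injective, the right
  side is not zero.
\<close>

lemma fold_germ_imp_second_deriv_nonzero:
  assumes "fold_germ P"
  shows "second_deriv p2 u u \<noteq> 0"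
proof
  assume Q0: "second_deriv p2 u u = 0"
  obtain \<phi> \<psi> where "diffeo_germ \<phi>" "diffeo_germ \<psi>"
    and ev: "\<forall>\<^sub>F x in nhds 0. \<psi> (P x) = vector [\<phi> x $ 1, (\<phi> x $ 2)\<^sup>2]"
    using assms unfolding fold_germ_def A_equiv_def by blast
  have \<phi>0: "\<phi> 0 = 0" and \<psi>0: "\<psi> 0 = 0"
    using \<open>diffeo_germ \<phi>\<close> \<open>diffeo_germ \<psi>\<close> by (simp_all add: diffeo_germ_def)
  obtain A where A: "0 \<in> A" "smooth_on A \<phi>"
    and inj: "\<And>v. frechet_derivative \<phi> (at 0) v = 0 \<Longrightarrow> v = 0"
    using diffeo_germ_deriv_inj[OF \<open>diffeo_germ \<phi>\<close>] by metis
  obtain B where B: "0 \<in> B" "smooth_on B \<psi>"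
    using diffeo_germ_deriv_inj[OF \<open>diffeo_germ \<psi>\<close>] by metis
  obtain S where S: "open S" "0 \<in> S"
    and eq: "\<And>x. x \<in> S \<Longrightarrow> \<psi> (P x) = vector [\<phi> x $ 1, (\<phi> x $ 2)\<^sup>2]"
    using ev by (auto simp: eventually_nhds)
  define N where "N = S \<inter> A \<inter> (U \<inter> P -` B)"
  have "open N"
  proof -
    have "open A" "open B" using A(2) B(2) by (simp_all add: smooth_on_def)
    then show ?thesis
      using continuous_open_preimage[OF smooth_on_continuous[OF smooth_P] open_U] S(1)
      unfolding N_def by (simp add: open_Int)
  qed
  have "0 \<in> N" using S A B zero P_0 by (simp add: N_def)
  have sm: "smooth_on N \<phi>" "smooth_on N P" "smooth_on N p1" "smooth_on N p2"
    using smooth_on_subset[OF _ \<open>open N\<close>] A(2) smooth_P smooth1 smooth2 by (auto simp: N_def)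
  define dpsi where "dpsi = (\<lambda>x. frechet_derivative \<psi> (at (P x)))"
  define dphi where "dphi = (\<lambda>x. frechet_derivative \<phi> (at x))"
  have chain: "dpsi x (frechet_derivative P (at x) v) = vector [dphi x v $ 1, 2 * \<phi> x $ 2 * dphi x v $ 2]"
    if "x \<in> N" for x v
  proof -
    have "P x \<in> B" using that by (simp add: N_def)
    have 1: "((\<lambda>x. \<psi> (P x)) has_derivative (\<lambda>v. dpsi x (frechet_derivative P (at x) v))) (at x)"
      unfolding dpsi_def
      by (rule has_derivative_compose[where g=\<psi> and f=P,
            OF smooth_on_has_derivative[OF sm(2) that] smooth_on_has_derivative[OF B(2) \<open>P x \<in> B\<close>]])
    have c: "((\<lambda>x. \<phi> x $ i) has_derivative (\<lambda>v. dphi x v $ i)) (at x)" for i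
      unfolding dphi_def
      by (intro bounded_linear.has_derivative[OF bounded_linear_vec_nth]
          smooth_on_has_derivative[OF sm(1) that])
    have "((\<lambda>x. vector [\<phi> x $ 1, \<phi> x $ 2 * \<phi> x $ 2] :: real^2) has_derivative
        (\<lambda>v. vector [dphi x v $ 1, \<phi> x $ 2 * dphi x v $ 2 + dphi x v $ 2 * \<phi> x $ 2])) (at x)"
      unfolding vector_2_eq
      by (intro has_derivative_add has_derivative_scaleR_left has_derivative_mult c)
    then have 2: "((\<lambda>x. \<psi> (P x)) has_derivative
        (\<lambda>v. vector [dphi x v $ 1, \<phi> x $ 2 * dphi x v $ 2 + dphi x v $ 2 * \<phi> x $ 2])) (at x)"
      by (rule has_derivative_transform_within_open[OF _ \<open>open N\<close> that])
        (simp add: eq N_def power2_eq_square)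
    show ?thesis
      using fun_cong[OF has_derivative_unique[OF 1 2], of v] by (simp add: mult.assoc)
  qed
  define a where "a = (\<lambda>i x. dpsi x (axis i 1) $ 2)"
  have smooth_a: "smooth_on N (a i)" for i
    unfolding a_def dpsi_def
    by (intro smooth_on_nth smooth_on_compose[OF smooth_on_frechet_derivative[OF B(2)] sm(2)])
      (auto simp: N_def)
  have lin: "linear (dpsi x)" if "x \<in> N" for x
    unfolding dpsi_def using that
    by (intro has_derivative_linear[OF smooth_on_has_derivative[OF B(2)]]) (simp add: N_def)
  have first: "a 1 x * frechet_derivative p1 (at x) v + a 2 x * frechet_derivative p2 (at x) v
      = 2 * \<phi> x $ 2 * dphi x v $ 2" if "x \<in> N" for x v
  proof -
    have "x \<in> U" using that by (simp add: N_def)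
    have "dpsi x (frechet_derivative P (at x) v) $ 2 = 2 * \<phi> x $ 2 * dphi x v $ 2"
      by (simp add: chain[OF that])
    then show ?thesis
      unfolding linear_2[OF lin[OF that], of "frechet_derivative P (at x) v"]
      by (simp add: dP[OF \<open>x \<in> U\<close>] a_def mult.commute)
  qed
  have a1: "a 1 0 = 0"
    using first[OF \<open>0 \<in> N\<close>, of "axis 2 1"] by (simp add: \<phi>0 dp1_0 dp2_0)
  have dp1_u: "frechet_derivative p1 (at 0) u = 0" by (simp add: dp1_0 u_def)
  have d: "(f has_derivative frechet_derivative f (at 0)) (at 0)" if "smooth_on N f"
    for f :: "real^2 \<Rightarrow> real"
    by (rule smooth_on_has_derivative[OF that \<open>0 \<in> N\<close>])
  have "((\<lambda>x. a 1 x * frechet_derivative p1 (at x) u + a 2 x * frechet_derivative p2 (at x) u)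
      has_derivative (\<lambda>v.
        (a 1 0 * second_deriv p1 u v
          + frechet_derivative (a 1) (at 0) v * frechet_derivative p1 (at 0) u)
      + (a 2 0 * second_deriv p2 u v
          + frechet_derivative (a 2) (at 0) v * frechet_derivative p2 (at 0) u))) (at 0)"
    by (intro has_derivative_add has_derivative_mult d smooth_a
        has_derivative_second_deriv[OF smooth1 zero] has_derivative_second_deriv[OF smooth2 zero])
  then have 1: "((\<lambda>x. a 1 x * frechet_derivative p1 (at x) u + a 2 x * frechet_derivative p2 (at x) u)
      has_derivative (\<lambda>v. a 2 0 * second_deriv p2 u v)) (at 0)"
    by (simp add: a1 dp1_u dp2_0)
  have s\<phi>: "smooth_on N (\<lambda>x. \<phi> x $ 2)" "smooth_on N (\<lambda>x. 2 * dphi x u $ 2)"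
    unfolding dphi_def using sm(1)
    by (intro smooth_on_nth smooth_on_cmult smooth_on_frechet_derivative; assumption)+
  have "((\<lambda>x. \<phi> x $ 2) has_derivative (\<lambda>v. dphi 0 v $ 2)) (at 0)"
    unfolding dphi_def
    by (intro bounded_linear.has_derivative[OF bounded_linear_vec_nth]
        smooth_on_has_derivative[OF sm(1) \<open>0 \<in> N\<close>])
  from has_derivative_mult[OF this d[OF s\<phi>(2)]]
  have 2: "((\<lambda>x. \<phi> x $ 2 * (2 * dphi x u $ 2)) has_derivative (\<lambda>v. dphi 0 v $ 2 * (2 * dphi 0 u $ 2))) (at 0)"
    by (simp add: \<phi>0)
  have "((\<lambda>x. a 1 x * frechet_derivative p1 (at x) u + a 2 x * frechet_derivative p2 (at x) u)
      has_derivative (\<lambda>v. dphi 0 v $ 2 * (2 * dphi 0 u $ 2))) (at 0)"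
    by (rule has_derivative_transform_within_open[OF 2 \<open>open N\<close> \<open>0 \<in> N\<close>]) (simp add: first)
  from fun_cong[OF has_derivative_unique[OF this 1], of u] Q0
  have "dphi 0 u $ 2 = 0" by simp
  moreover have "dphi 0 u $ 1 = 0"
  proof -
    have "frechet_derivative P (at 0) u = 0" by (simp add: dP zero dp1_u dp2_0 vector_2_eq_0_iff)
    then have "vector [dphi 0 u $ 1, 2 * \<phi> 0 $ 2 * dphi 0 u $ 2] = (0 :: real^2)"
      using chain[OF \<open>0 \<in> N\<close>, of u] linear_0[OF lin[OF \<open>0 \<in> N\<close>]] by simp
    then show ?thesis by (simp add: vector_2_eq_0_iff)
  qed
  ultimately have "u = 0" using inj[of u] by (simp add: dphi_def vec_eq_iff forall_2)
  then show False by (simp add: u_def vector_2_eq_0_iff)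
qed

definition \<Theta> :: "real^2 \<Rightarrow> real^2" where "\<Theta> x = vector [p1 x, D x]"

lemma smooth_\<Theta>: "smooth_on U \<Theta>"
  unfolding \<Theta>_def[abs_def] by (intro smooth_on_vector_2 smooth1 smooth_D)

lemma \<Theta>_0: "\<Theta> 0 = 0"
  by (simp add: \<Theta>_def p1_0 D_0 vector_2_eq_0_iff)

lemma inj_dp1_dD:
  assumes "second_deriv p2 u u \<noteq> 0"
    and "frechet_derivative p1 (at 0) v = 0" "frechet_derivative D (at 0) v = 0"
  shows "v = 0"
proof -
  have "v = v$1 *\<^sub>R u" using assms(2) by (simp add: dp1_0 u_def vec_eq_iff forall_2)
  moreover have "second_deriv p2 u (v$1 *\<^sub>R u) = v$1 * second_deriv p2 u u"
    using linear_scale[OF has_derivative_linear[OF has_derivative_second_deriv[OF smooth2 zero]]]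
    by simp
  ultimately have "v$1 * second_deriv p2 u u = 0"
    using assms(3) unfolding dD_0 by (metis neg_equal_0_iff_equal)
  then have "v$1 = 0" using assms(1) by simp
  then show ?thesis using \<open>v = v$1 *\<^sub>R u\<close> by simp
qed

definition box2 :: "real \<Rightarrow> (real^2) set" where "box2 \<epsilon> = {y. \<bar>y$1\<bar> < \<epsilon> \<and> \<bar>y$2\<bar> < \<epsilon>}"

lemma open_box2: "open (box2 \<epsilon>)"
  unfolding box2_def by (intro open_Collect_conj open_Collect_less continuous_intros)

lemma convex_box2: "convex (box2 \<epsilon>)"
proof -
  have "box2 \<epsilon> = (\<lambda>y. y$1) -` {-\<epsilon><..<\<epsilon>} \<inter> (\<lambda>y. y$2) -` {-\<epsilon><..<\<epsilon>}"
    by (auto simp: box2_def)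
  then show ?thesis
    by (simp add: convex_Int convex_linear_vimage bounded_linear.linear[OF bounded_linear_vec_nth])
qed

text \<open>
  If \<open>p2''(u, u) \<noteq> 0\<close>, then \<open>p1\<close> and the Jacobian determinant \<open>D\<close> form a system of coordinates
  around the origin in which the singular set is a coordinate axis.
\<close>

lemma straighten_singular_set:
  assumes "second_deriv p2 u u \<noteq> 0" and "open N" "0 \<in> N" "N \<subseteq> U"
  obtains W \<epsilon> g where "\<epsilon> > 0" "open W" "0 \<in> W" "W \<subseteq> N" "smooth_on (box2 \<epsilon>) g"
    "homeomorphism W (box2 \<epsilon>) \<Theta> g"
proof -
  have sN: "smooth_on N \<Theta>" using smooth_on_subset[OF smooth_\<Theta> assms(2,4)] .
  have "v = 0" if "frechet_derivative \<Theta> (at 0) v = 0" for v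
    using that inj_dp1_dD[OF assms(1)]
    unfolding \<Theta>_def[abs_def] frechet_derivative_vector_2[OF smooth1 smooth_D zero]
    by (simp add: vector_2_eq_0_iff)
  from smooth_local_inverse[OF sN \<open>0 \<in> N\<close> this]
  obtain U' V g where *: "open U'" "U' \<subseteq> N" "0 \<in> U'" "open V" "homeomorphism U' V \<Theta> g" "smooth_on V g"
    by metis
  have "0 \<in> V" using *(3,5) \<Theta>_0 by (force simp: homeomorphism_def)
  then obtain r where "r > 0" and r: "ball 0 r \<subseteq> V" using \<open>open V\<close> openE by blast
  have sub: "box2 (r/2) \<subseteq> V"
  proof
    fix y assume y: "y \<in> box2 (r/2)"
    have "norm y \<le> \<bar>y$1\<bar> + \<bar>y$2\<bar>" using norm_le_l1_cart[of y] by (simp add: sum_2)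
    then show "y \<in> V" using y r by (auto simp: box2_def)
  qed
  define W where "W = U' \<inter> \<Theta> -` box2 (r/2)"
  have g: "g y \<in> U'" "\<Theta> (g y) = y" if "y \<in> V" for y
    using *(5) that by (auto simp: homeomorphism_def)
  have "homeomorphism W (box2 (r/2)) \<Theta> g"
  proof (rule homeomorphism_of_subsets[OF *(5)])
    have "y \<in> \<Theta> ` W" if "y \<in> box2 (r/2)" for y
    proof
      have "y \<in> V" using sub that by blast
      then show "y = \<Theta> (g y)" "g y \<in> W" using g that by (simp_all add: W_def)
    qed
    then show "\<Theta> ` W = box2 (r/2)" by (auto simp: W_def)
  qed (use sub in \<open>auto simp: W_def\<close>)
  moreover have "open W"
    unfolding W_def
    using continuous_open_preimage[OF _ *(1) open_box2] *(5) by (auto simp: homeomorphism_def)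
  moreover have "smooth_on (box2 (r/2)) g" using smooth_on_subset[OF *(6) open_box2 sub] .
  ultimately show ?thesis
    using that[of "r/2" W g] \<open>r > 0\<close> *(2,3) \<Theta>_0 by (auto simp: W_def box2_def)
qed

text \<open>
  The derivative of \<open>D\<close> along the field \<open>(- \<partial>\<^sub>2 p1, \<partial>\<^sub>1 p1)\<close>, which is tangent to the level curves
  of \<open>p1\<close>.
\<close>

definition rho :: "real^2 \<Rightarrow> real" where
  "rho x = pd p1 1 x * pd D 2 x - pd p1 2 x * pd D 1 x"

lemma smooth_rho: "smooth_on U rho"
  unfolding rho_def[abs_def]
  by (intro smooth_on_diff smooth_on_mult smooth_pd smooth_on_frechet_derivative[OF smooth_D])

lemma rho_0: "rho 0 = second_deriv p2 u u"
proof -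
  have "rho 0 = - frechet_derivative D (at 0) u"
    unfolding frechet_derivative_2[OF smooth_D zero, of u] by (simp add: rho_def dp1_0 u_def)
  then show ?thesis by (simp add: dD_0)
qed

text \<open>
  The curves on which only the second straightening coordinate moves are level curves of \<open>p1\<close>, so
  their velocity is a multiple of \<open>(- \<partial>\<^sub>2 p1, \<partial>\<^sub>1 p1)\<close>; it is \<open>1 / rho\<close> times this field because \<open>D\<close>
  grows at unit speed. The derivative of \<open>p2\<close> along the field is \<open>D\<close> itself.
\<close>

lemma deriv_along_coordinate:
  assumes g: "smooth_on (box2 \<epsilon>) g" and hom: "homeomorphism W (box2 \<epsilon>) \<Theta> g" and "W \<subseteq> U"
    and y: "y \<in> box2 \<epsilon>" and "rho (g y) \<noteq> 0"
  shows "frechet_derivative (\<lambda>y. p2 (g y)) (at y) (axis 2 1) = y$2 / rho (g y)"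
proof -
  have "g y \<in> U" using hom y \<open>W \<subseteq> U\<close> by (auto simp: homeomorphism_def)
  have gy: "p1 (g z) = z$1" "D (g z) = z$2" if "z \<in> box2 \<epsilon>" for z
    using hom that by (auto simp: homeomorphism_def \<Theta>_def vec_eq_iff forall_2)
  define a where "a = frechet_derivative g (at y) (axis 2 1)"
  have chain: "((\<lambda>y. f (g y)) has_derivative
      (\<lambda>v. frechet_derivative f (at (g y)) (frechet_derivative g (at y) v))) (at y)"
    if "smooth_on U f" for f :: "real^2 \<Rightarrow> real"
    by (rule has_derivative_compose[where g=f and f=g, OF smooth_on_has_derivative[OF g y]
          smooth_on_has_derivative[OF that \<open>g y \<in> U\<close>]])
  have nth: "frechet_derivative f (at (g y)) a = axis 2 1 $ i"
    if "smooth_on U f" "\<And>z. z \<in> box2 \<epsilon> \<Longrightarrow> f (g z) = z $ i" for f :: "real^2 \<Rightarrow> real" and i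
  proof -
    have "((\<lambda>z. z $ i) has_derivative
        (\<lambda>v. frechet_derivative f (at (g y)) (frechet_derivative g (at y) v))) (at y)"
      by (rule has_derivative_transform_within_open[OF chain[OF that(1)] open_box2 y that(2)])
    from has_derivative_unique[OF this bounded_linear_imp_has_derivative[OF bounded_linear_vec_nth]]
    show ?thesis unfolding a_def by (rule fun_cong)
  qed
  have 1: "a$1 * pd p1 1 (g y) + a$2 * pd p1 2 (g y) = 0"
    using nth[OF smooth1 gy(1)] unfolding frechet_derivative_2[OF smooth1 \<open>g y \<in> U\<close>, of a] by simp
  have 2: "a$1 * pd D 1 (g y) + a$2 * pd D 2 (g y) = 1"
    using nth[OF smooth_D gy(2)] unfolding frechet_derivative_2[OF smooth_D \<open>g y \<in> U\<close>, of a] by simp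
  have "rho (g y) * a$1 = - pd p1 2 (g y)" "rho (g y) * a$2 = pd p1 1 (g y)"
    unfolding rho_def using 1 2 by algebra+
  then have "rho (g y) * (a$1 * pd p2 1 (g y) + a$2 * pd p2 2 (g y)) = D (g y)"
    unfolding D_def by algebra
  moreover have "frechet_derivative (\<lambda>y. p2 (g y)) (at y) (axis 2 1)
      = a$1 * pd p2 1 (g y) + a$2 * pd p2 2 (g y)"
  proof -
    have "frechet_derivative (\<lambda>y. p2 (g y)) (at y) (axis 2 1) = frechet_derivative p2 (at (g y)) a"
      unfolding a_def by (rule frechet_derivative_eqI[OF chain[OF smooth2]])
    then show ?thesis by (simp only: frechet_derivative_2[OF smooth2 \<open>g y \<in> U\<close>, of a])
  qed
  ultimately show ?thesis
    using gy(2)[OF y] \<open>rho (g y) \<noteq> 0\<close> by (simp add: field_simps)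
qed

text \<open>
  In the coordinates \<open>y = (p1, D)\<close> the partial derivative \<open>\<partial>\<^sub>2 p2\<close> is \<open>y\<^sub>2 / rho\<close>. Integrating it from
  the axis \<open>y\<^sub>2 = 0\<close> gives \<open>p2 = b(y\<^sub>1) + s y\<^sub>2\<^sup>2 k(y)\<close> with the smooth factor
  \<open>k(y) = \<integral> t s / rho(y\<^sub>1, t y\<^sub>2) dt\<close> over \<open>[0, 1]\<close>, which is positive near the origin when \<open>s\<close> is
  the sign of \<open>rho\<close> there. Then \<open>\<phi> = (p1, D \<surd>k)\<close> in the source and \<open>\<psi>(z) = (z\<^sub>1, s (z\<^sub>2 - b(z\<^sub>1)))\<close> in
  the target bring the germ to the form \<open>(x, y\<^sup>2)\<close>.
\<close>

lemma second_deriv_nonzero_imp_fold_germ: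
  assumes Q: "second_deriv p2 u u \<noteq> 0"
  shows "fold_germ P"
proof -
  define s where "s = sgn (rho 0)"
  have ss: "s * s = 1" using Q by (auto simp: s_def rho_0 sgn_if)
  define N where "N = U \<inter> (\<lambda>x. s * rho x) -` {0<..}"
  have "open N"
    unfolding N_def
    by (intro continuous_open_preimage open_U smooth_on_continuous smooth_on_cmult smooth_rho) simp
  have "0 \<in> N" using Q zero by (simp add: N_def s_def rho_0 sgn_if)
  have "N \<subseteq> U" by (auto simp: N_def)
  obtain W \<epsilon> g where W: "\<epsilon> > 0" "open W" "0 \<in> W" "W \<subseteq> N" "smooth_on (box2 \<epsilon>) g"
    and hom: "homeomorphism W (box2 \<epsilon>) \<Theta> g"
    using straighten_singular_set[OF Q \<open>open N\<close> \<open>0 \<in> N\<close> \<open>N \<subseteq> U\<close>] by metis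
  have gN: "g y \<in> N" "\<Theta> (g y) = y" if "y \<in> box2 \<epsilon>" for y
    using hom that W(4) by (auto simp: homeomorphism_def)
  have g\<Theta>: "g (\<Theta> x) = x" "\<Theta> x \<in> box2 \<epsilon>" if "x \<in> W" for x
    using hom that by (auto simp: homeomorphism_def)
  have g_0: "g 0 = 0" using g\<Theta>(1)[OF W(3)] \<Theta>_0 by simp
  define m where "m = (\<lambda>y. s / rho (g y))"
  have rho_pos: "s * rho (g y) > 0" "rho (g y) \<noteq> 0" if "y \<in> box2 \<epsilon>" for y
    using gN(1)[OF that] by (auto simp: N_def)
  have m_pos: "m y > 0" if "y \<in> box2 \<epsilon>" for y
  proof -
    have "m y = s * rho (g y) / (rho (g y))\<^sup>2" by (simp add: m_def power2_eq_square)
    then show ?thesis using rho_pos[OF that] by simp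
  qed
  have sg: "smooth_on (box2 \<epsilon>) (\<lambda>y. f (g y))" if "smooth_on U f" for f :: "real^2 \<Rightarrow> real"
    using gN(1) \<open>N \<subseteq> U\<close> by (intro smooth_on_compose[OF that W(5)]) auto
  have smooth_m: "smooth_on (box2 \<epsilon>) m"
    unfolding m_def
    by (intro smooth_on_divide smooth_on_const open_box2 sg smooth_rho rho_pos)
  define S where "S = box2 (\<epsilon> / 2)"
  have S: "open S" "convex S" "S \<subseteq> box2 \<epsilon>" "0 \<in> S"
    using \<open>\<epsilon> > 0\<close> by (auto simp: S_def open_box2 convex_box2) (auto simp: box2_def)
  \<comment> \<open>The domain is halved so that the integrand is also defined for \<open>t\<close> slightly above \<open>1\<close>.\<close>
  have in_box: "vector [y$1, t * y$2] \<in> box2 \<epsilon>" if "y \<in> S" "t \<in> {-2<..<2}" for y and t :: real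
  proof -
    have "\<bar>t * y$2\<bar> \<le> 2 * \<bar>y$2\<bar>" using that(2) by (auto simp: abs_mult intro: mult_right_mono)
    then show ?thesis using that by (auto simp: S_def box2_def)
  qed
  define k where "k = (\<lambda>y::real^2. integral {0..1} (\<lambda>t. t * m (vector [y$1, t * y$2])))"
  have smooth_k: "smooth_on S k"
  proof -
    have o: "open (S \<times> {-2<..<2::real})" using S(1) by (simp add: open_Times)
    have c: "smooth_on (S \<times> {-2<..<2::real}) (\<lambda>p. fst p $ i)" "smooth_on (S \<times> {-2<..<2::real}) snd" for i
      using o by (auto intro!: smooth_on_bounded_linear[OF _ smooth_on_id] smooth_on_nth
          bounded_linear_fst bounded_linear_snd)
    have "smooth_on (S \<times> {-2<..<2}) (\<lambda>p. snd p * m (vector [fst p $ 1, snd p * fst p $ 2]))"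
      by (intro smooth_on_mult c smooth_on_compose[OF smooth_m] smooth_on_vector_2)
        (use in_box in auto)
    from smooth_on_integral[OF S(1,2) _ _ this] show ?thesis by (simp add: k_def subset_iff)
  qed
  have p2_eq: "s * (p2 (g y) - p2 (g (vector [y$1, 0]))) = (y$2)\<^sup>2 * k y" if "y \<in> S" for y
  proof -
    define c where "c = (\<lambda>t. vector [y$1, t * y$2] :: real^2)"
    have c: "c t \<in> box2 \<epsilon>" if "t \<in> {0..1}" for t using in_box[OF \<open>y \<in> S\<close>, of t] that by (simp add: c_def)
    have "((\<lambda>t. (y$2)\<^sup>2 * (t * m (c t))) has_integral s * p2 (g (c 1)) - s * p2 (g (c 0))) {0..1}"
    proof (rule fundamental_theorem_of_calculus)
      fix t :: real assume t: "t \<in> {0..1}"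
      have "(c has_derivative (\<lambda>h. h *\<^sub>R (y$2 *\<^sub>R axis 2 1))) (at t)"
        unfolding c_def vector_2_eq by (auto intro!: derivative_eq_intros)
      from has_derivative_compose[where g="\<lambda>y. p2 (g y)" and f=c,
          OF this smooth_on_has_derivative[OF sg[OF smooth2] c[OF t]]]
      have "((\<lambda>t. p2 (g (c t))) has_derivative
          (\<lambda>h. frechet_derivative (\<lambda>y. p2 (g y)) (at (c t)) (h *\<^sub>R (y$2 *\<^sub>R axis 2 1)))) (at t)" .
      moreover have "frechet_derivative (\<lambda>y. p2 (g y)) (at (c t)) (h *\<^sub>R (y$2 *\<^sub>R axis 2 1))
          = h * (y$2 * (t * y$2 / rho (g (c t))))" for h
      proof -
        have "linear (frechet_derivative (\<lambda>y. p2 (g y)) (at (c t)))"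
          by (rule has_derivative_linear[OF smooth_on_has_derivative[OF sg[OF smooth2] c[OF t]]])
        moreover have "frechet_derivative (\<lambda>y. p2 (g y)) (at (c t)) (axis 2 1)
            = t * y$2 / rho (g (c t))"
          using deriv_along_coordinate[OF W(5) hom _ c[OF t] rho_pos(2)[OF c[OF t]]] W(4) \<open>N \<subseteq> U\<close>
          by (auto simp: c_def)
        ultimately show ?thesis by (simp add: linear_scale)
      qed
      ultimately have "((\<lambda>t. p2 (g (c t))) has_vector_derivative y$2 * (t * y$2 / rho (g (c t)))) (at t)"
        by (simp add: has_vector_derivative_def)
      from has_vector_derivative_mult_right[OF this, of s]
      have "((\<lambda>t. s * p2 (g (c t))) has_vector_derivative (y$2)\<^sup>2 * (t * m (c t))) (at t)"
        by (simp add: m_def power2_eq_square mult_ac)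
      then show "((\<lambda>t. s * p2 (g (c t))) has_vector_derivative (y$2)\<^sup>2 * (t * m (c t))) (at t within {0..1})"
        by (rule has_vector_derivative_at_within)
    qed simp
    then have "integral {0..1} (\<lambda>t. (y$2)\<^sup>2 * (t * m (c t))) = s * p2 (g (c 1)) - s * p2 (g (c 0))"
      by (rule integral_unique)
    moreover have "c 1 = y" by (simp add: c_def vec_eq_iff forall_2)
    ultimately show ?thesis by (simp add: k_def c_def right_diff_distrib)
  qed
  have "k 0 > 0"
  proof -
    have "vector [0, 0] = (0 :: real^2)" by (simp add: vector_2_eq_0_iff)
    then have "k 0 = integral {0..1} (\<lambda>t::real. t) * m 0" by (simp add: k_def)
    also have "integral {0..1} (\<lambda>t::real. t) = 1 / 2"
      using ident_has_integral[of 0 "1::real"] by (simp add: integral_unique)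
    finally show ?thesis using m_pos[of 0] S(3,4) by auto
  qed
  define S' where "S' = S \<inter> k -` {0<..}"
  have "open S'"
    unfolding S'_def by (intro continuous_open_preimage smooth_on_continuous smooth_k S) simp
  define W' where "W' = W \<inter> \<Theta> -` S'"
  have "W \<subseteq> U" using W(4) \<open>N \<subseteq> U\<close> by blast
  have "open W'"
    unfolding W'_def
    by (intro continuous_open_preimage smooth_on_continuous smooth_on_subset[OF smooth_\<Theta>]
        \<open>open W\<close> \<open>W \<subseteq> U\<close> \<open>open S'\<close>)
  have "0 \<in> W'" using W(3) \<Theta>_0 S(4) \<open>k 0 > 0\<close> by (simp add: W'_def S'_def)
  have "W' \<subseteq> U" using \<open>W \<subseteq> U\<close> by (auto simp: W'_def)
  define \<kappa> where "\<kappa> = (\<lambda>x. sqrt (k (\<Theta> x)))"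
  have smooth_\<kappa>: "smooth_on W' \<kappa>"
    unfolding \<kappa>_def
    by (intro smooth_on_sqrt smooth_on_compose[OF smooth_k]
        smooth_on_subset[OF smooth_\<Theta> \<open>open W'\<close> \<open>W' \<subseteq> U\<close>]) (auto simp: W'_def S'_def)
  have smW': "smooth_on W' p1" "smooth_on W' D" "smooth_on W' (\<lambda>x. D x * \<kappa> x)"
    using smooth_on_subset[OF _ \<open>open W'\<close> \<open>W' \<subseteq> U\<close>] smooth1 smooth_D smooth_\<kappa>
    by (auto intro: smooth_on_mult)
  define \<phi> where "\<phi> = (\<lambda>x. vector [p1 x, D x * \<kappa> x] :: real^2)"
  have "diffeo_germ \<phi>"
  proof (rule diffeo_germI[OF _ \<open>0 \<in> W'\<close>])
    show "smooth_on W' \<phi>" unfolding \<phi>_def by (intro smooth_on_vector_2 smW')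
    show "\<phi> 0 = 0" by (simp add: \<phi>_def p1_0 D_0 vector_2_eq_0_iff)
    have "\<kappa> 0 \<noteq> 0" using \<open>k 0 > 0\<close> by (simp add: \<kappa>_def \<Theta>_0)
    then show "v = 0" if "frechet_derivative \<phi> (at 0) v = 0" for v
      using that inj_dp1_dD[OF Q, of v]
        frechet_derivative_mult_zero[OF smW'(2) smooth_\<kappa> \<open>0 \<in> W'\<close> D_0, of v]
      unfolding \<phi>_def frechet_derivative_vector_2[OF smW'(1,3) \<open>0 \<in> W'\<close>]
      by (simp add: vector_2_eq_0_iff)
  qed
  define V where "V = {z::real^2. \<bar>z$1\<bar> < \<epsilon>}"
  have "open V" unfolding V_def by (intro open_Collect_less continuous_intros)
  have "0 \<in> V" using \<open>\<epsilon> > 0\<close> by (simp add: V_def)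
  define b where "b = (\<lambda>z::real^2. p2 (g (vector [z$1, 0])))"
  have smooth_b: "smooth_on V b"
    unfolding b_def using \<open>\<epsilon> > 0\<close>
    by (intro smooth_on_compose[OF sg[OF smooth2]] smooth_on_vector_2 smooth_on_nth smooth_on_id
        smooth_on_const \<open>open V\<close>) (auto simp: V_def box2_def)
  have db_0: "frechet_derivative b (at 0) v = 0" for v
  proof -
    have 0: "vector [(0::real^2)$1, 0] = (0 :: real^2)" by (simp add: vector_2_eq_0_iff)
    have "smooth_on V (\<lambda>z. g (vector [z$1, 0]))"
      using \<open>\<epsilon> > 0\<close>
      by (intro smooth_on_compose[OF W(5)] smooth_on_vector_2 smooth_on_nth smooth_on_id
          smooth_on_const \<open>open V\<close>) (auto simp: V_def box2_def)
    from smooth_on_has_derivative[OF this \<open>0 \<in> V\<close>]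
    have "(b has_derivative (\<lambda>v. frechet_derivative p2 (at 0)
        (frechet_derivative (\<lambda>z. g (vector [z$1, 0])) (at 0) v))) (at 0)"
      unfolding b_def
      by (rule has_derivative_compose[where g=p2])
        (use smooth_on_has_derivative[OF smooth2 zero] g_0 0 in simp)
    then show ?thesis by (simp add: frechet_derivative_eqI dp2_0)
  qed
  define \<psi> where "\<psi> = (\<lambda>z::real^2. vector [z$1, s * (z$2 - b z)] :: real^2)"
  have sm: "smooth_on V (\<lambda>z::real^2. z $ i)" for i using \<open>open V\<close> by (intro smooth_on_nth smooth_on_id)
  have sm2: "smooth_on V (\<lambda>z. s * (z$2 - b z))"
    by (intro smooth_on_cmult smooth_on_diff sm smooth_b)
  have "diffeo_germ \<psi>"
  proof (rule diffeo_germI[OF _ \<open>0 \<in> V\<close>])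
    show "smooth_on V \<psi>" unfolding \<psi>_def by (intro smooth_on_vector_2 sm sm2)
    have b_0: "b 0 = 0" using g_0 vector_2_eq_0_iff[of 0 0] by (simp add: b_def p2_0)
    then show "\<psi> 0 = 0" by (simp add: \<psi>_def vector_2_eq_0_iff)
    fix v :: "real^2" assume v: "frechet_derivative \<psi> (at 0) v = 0"
    have nth: "((\<lambda>z::real^2. z $ i) has_derivative (\<lambda>v. v $ i)) (at 0)" for i
      by (rule bounded_linear_imp_has_derivative[OF bounded_linear_vec_nth])
    have "((\<lambda>z. s * (z$2 - b z)) has_derivative (\<lambda>v. s * (v$2 - frechet_derivative b (at 0) v))) (at 0)"
      by (intro has_derivative_mult_right has_derivative_diff nth
          smooth_on_has_derivative[OF smooth_b \<open>0 \<in> V\<close>])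
    then have "s * v$2 = 0" "v$1 = 0"
      using v frechet_derivative_eqI[OF nth, of 1 v] unfolding \<psi>_def frechet_derivative_vector_2[OF sm sm2 \<open>0 \<in> V\<close>]
      by (simp_all add: vector_2_eq_0_iff frechet_derivative_eqI db_0)
    then show "v = 0" using ss by (auto simp: vec_eq_iff forall_2)
  qed
  moreover have "\<forall>\<^sub>F x in nhds 0. \<psi> (P x) = vector [\<phi> x $ 1, (\<phi> x $ 2)\<^sup>2]"
    unfolding eventually_nhds
  proof (intro exI[of _ W'] conjI ballI)
    fix x assume "x \<in> W'"
    then have x: "\<Theta> x \<in> S" "k (\<Theta> x) > 0" "x \<in> W" by (auto simp: W'_def S'_def)
    have "s * (p2 x - b (P x)) = (D x)\<^sup>2 * k (\<Theta> x)"
      using p2_eq[OF x(1)] g\<Theta>(1)[OF x(3)] by (simp add: b_def P_def \<Theta>_def)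
    also have "\<dots> = (D x * \<kappa> x)\<^sup>2"
      using x(2) by (simp add: \<kappa>_def power_mult_distrib)
    finally show "\<psi> (P x) = vector [\<phi> x $ 1, (\<phi> x $ 2)\<^sup>2]"
      by (simp add: \<psi>_def \<phi>_def P_def)
  qed (use \<open>open W'\<close> \<open>0 \<in> W'\<close> in auto)
  ultimately show ?thesis
    using \<open>diffeo_germ \<phi>\<close> unfolding fold_germ_def A_equiv_def by blast
qed

theorem fold_germ_iff: "fold_germ P \<longleftrightarrow> second_deriv p2 u u \<noteq> 0"
  using fold_germ_imp_second_deriv_nonzero second_deriv_nonzero_imp_fold_germ by blast

section \<open>Curvature of the apparent contour\<close>

text \<open>
  The singular set is the axis \<open>D = 0\<close> of the straightening coordinates. With \<open>p1\<close> as parameter the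
  contour is the graph of a function, hence regular.
\<close>

lemma contour_param_exists:
  assumes Q: "second_deriv p2 u u \<noteq> 0"
  obtains W \<epsilon> \<gamma> where "open W" "0 \<in> W" "W \<subseteq> U" "contour_param W P \<epsilon> \<gamma>"
proof -
  obtain W \<epsilon> g where W: "\<epsilon> > 0" "open W" "0 \<in> W" "W \<subseteq> U" "smooth_on (box2 \<epsilon>) g"
    and hom: "homeomorphism W (box2 \<epsilon>) \<Theta> g"
    using straighten_singular_set[OF Q open_U zero order_refl] by metis
  define I where "I = {-\<epsilon><..<\<epsilon>}"
  have g: "g y \<in> W" "p1 (g y) = y$1" "D (g y) = y$2" if "y \<in> box2 \<epsilon>" for y
  proof -
    have "g y \<in> W" "\<Theta> (g y) = y" using hom that by (auto simp: homeomorphism_def)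
    then show "g y \<in> W" "p1 (g y) = y$1" "D (g y) = y$2"
      by (auto simp: \<Theta>_def vec_eq_iff forall_2)
  qed
  have g\<Theta>: "g (\<Theta> x) = x" "\<Theta> x \<in> box2 \<epsilon>" if "x \<in> W" for x
    using hom that by (auto simp: homeomorphism_def)
  define \<sigma> where "\<sigma> = (\<lambda>t. g (vector [t, 0]))"
  define \<gamma> where "\<gamma> = (\<lambda>t. P (\<sigma> t))"
  have box: "vector [t, 0] \<in> box2 \<epsilon>" if "t \<in> I" for t
    using that by (auto simp: box2_def I_def)
  have "open I" by (simp add: I_def)
  have smooth_\<sigma>: "smooth_on I \<sigma>"
    unfolding \<sigma>_def
    by (intro smooth_on_compose[OF W(5)] smooth_on_vector_2 smooth_on_id smooth_on_const \<open>open I\<close>)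
      (use box in auto)
  have smooth_\<gamma>: "smooth_on I \<gamma>"
    unfolding \<gamma>_def
    by (intro smooth_on_compose[OF smooth_P smooth_\<sigma>]) (use g(1)[OF box] W(4) in \<open>auto simp: \<sigma>_def\<close>)
  have "vector_derivative \<gamma> (at t) \<noteq> 0" if "t \<in> I" for t
  proof -
    have \<gamma>1: "\<gamma> t $ 1 = t" if "t \<in> I" for t
      using g(2)[OF box[OF that]] by (simp add: \<gamma>_def \<sigma>_def P_def)
    have "\<gamma> differentiable (at t)"
      using smooth_on_has_derivative[OF smooth_\<gamma> that] differentiable_def by blast
    then have "((\<lambda>t. \<gamma> t $ 1) has_vector_derivative vector_derivative \<gamma> (at t) $ 1) (at t)"
      by (intro bounded_linear.has_vector_derivative[OF bounded_linear_vec_nth])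
        (simp add: vector_derivative_works[symmetric])
    then have "((\<lambda>t. t) has_vector_derivative vector_derivative \<gamma> (at t) $ 1) (at t)"
      by (rule has_vector_derivative_transform_within_open[OF _ \<open>open I\<close> that]) (rule \<gamma>1)
    from vector_derivative_unique_at[OF this has_vector_derivative_id]
    show ?thesis by auto
  qed
  moreover have "\<sigma> ` I = singular_set W P"
  proof -
    have "x \<in> \<sigma> ` I" if "x \<in> W" "D x = 0" for x
    proof
      show "x = \<sigma> (p1 x)" using g\<Theta>(1)[OF that(1)] that(2) by (simp add: \<Theta>_def \<sigma>_def)
      show "p1 x \<in> I" using g\<Theta>(2)[OF that(1)] by (auto simp: \<Theta>_def box2_def I_def)
    qed
    then show ?thesis
      using g[OF box] unfolding singular_set_P[OF W(4)] by (auto simp: \<sigma>_def)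
  qed
  moreover have "\<sigma> 0 = 0"
    using g\<Theta>(1)[OF W(3)] \<Theta>_0 vector_2_eq_0_iff[of 0 0] by (simp add: \<sigma>_def)
  ultimately have "contour_param W P \<epsilon> \<gamma>"
    using \<open>\<epsilon> > 0\<close> smooth_\<sigma> smooth_\<gamma> unfolding contour_param_def I_def \<gamma>_def by blast
  then show ?thesis using that W by blast
qed

text \<open>
  Let \<open>s\<close> be the velocity of the singular curve. The contour starts along the first axis and
  its acceleration has second component \<open>p2''(s, s)\<close>, so its curvature vanishes if and only if
  \<open>p2''(s, s) = 0\<close>. Since \<open>s\<close> is conjugate to \<open>u\<close>, that is \<open>p2''(u, s) = 0\<close>, the Gram determinant
  identity \<open>p2''(u, u) p2''(s, s) = det (p2'') (u \<and> s)\<^sup>2\<close> turns this into degeneracy of \<open>p2''\<close>; the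
  factor \<open>u \<and> s\<close> is the horizontal velocity of the contour, which is not zero.
\<close>

lemma curvature_zero_iff:
  assumes Q: "second_deriv p2 u u \<noteq> 0" and "W \<subseteq> U" and \<gamma>: "contour_param W P \<epsilon> \<gamma>"
  shows "plane_curvature \<gamma> 0 = 0 \<longleftrightarrow> det (hessian p2) = 0"
proof -
  define I where "I = {-\<epsilon><..<\<epsilon>}"
  obtain \<sigma> where "smooth_on I \<sigma>" and \<sigma>0: "\<sigma> 0 = 0" and im: "\<sigma> ` I = singular_set W P"
    and \<gamma>\<sigma>: "\<And>t. t \<in> I \<Longrightarrow> \<gamma> t = P (\<sigma> t)" and "\<epsilon> > 0" and "smooth_on I \<gamma>"
    and reg: "\<And>t. t \<in> I \<Longrightarrow> vector_derivative \<gamma> (at t) \<noteq> 0"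
    using \<gamma> unfolding contour_param_def I_def by blast
  have "open I" "0 \<in> I" using \<open>\<epsilon> > 0\<close> by (auto simp: I_def)
  have \<sigma>I: "\<sigma> t \<in> U" "D (\<sigma> t) = 0" if "t \<in> I" for t
    using im that \<open>W \<subseteq> U\<close> unfolding singular_set_P[OF \<open>W \<subseteq> U\<close>] by auto
  have vd: "vector_derivative f (at t) = frechet_derivative f (at t) 1"
    "(f has_derivative (\<lambda>h. h *\<^sub>R vector_derivative f (at t))) (at t)"
    if "smooth_on I f" "t \<in> I" for f :: "real \<Rightarrow> real^2" and t
  proof -
    have "f differentiable (at t)"
      using smooth_on_has_derivative[OF that] differentiable_def by blast
    then have 1: "(f has_vector_derivative vector_derivative f (at t)) (at t)"
      by (simp add: vector_derivative_works[symmetric])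
    then show "(f has_derivative (\<lambda>h. h *\<^sub>R vector_derivative f (at t))) (at t)"
      by (simp add: has_vector_derivative_def)
    then show "vector_derivative f (at t) = frechet_derivative f (at t) 1"
      by (simp add: frechet_derivative_eqI)
  qed
  define \<sigma>' where "\<sigma>' = (\<lambda>t. vector_derivative \<sigma> (at t))"
  define \<gamma>' where "\<gamma>' = (\<lambda>t. vector_derivative \<gamma> (at t))"
  define s where "s = \<sigma>' 0"
  have smooth': "smooth_on I \<sigma>'" "smooth_on I \<gamma>'"
    unfolding \<sigma>'_def \<gamma>'_def
    using smooth_on_cong[OF smooth_on_frechet_derivative[OF \<open>smooth_on I \<sigma>\<close>] vd(1)[symmetric]]
      smooth_on_cong[OF smooth_on_frechet_derivative[OF \<open>smooth_on I \<gamma>\<close>] vd(1)[symmetric]]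
      \<open>smooth_on I \<sigma>\<close> \<open>smooth_on I \<gamma>\<close> by blast+
  have chain: "((\<lambda>t. f (\<sigma> t)) has_derivative (\<lambda>h. h *\<^sub>R frechet_derivative f (at (\<sigma> t)) (\<sigma>' t))) (at t)"
    if "smooth_on U f" "t \<in> I" for f :: "real^2 \<Rightarrow> 'b::real_normed_vector" and t
  proof -
    have d: "(f has_derivative frechet_derivative f (at (\<sigma> t))) (at (\<sigma> t))"
      using smooth_on_has_derivative[OF that(1) \<sigma>I(1)[OF that(2)]] .
    show ?thesis
      using has_derivative_compose[where g=f and f=\<sigma>, OF vd(2)[OF \<open>smooth_on I \<sigma>\<close> that(2)] d]
      by (simp add: linear_scale[OF has_derivative_linear[OF d]] \<sigma>'_def)
  qed
  have \<gamma>'_eq: "\<gamma>' t = frechet_derivative P (at (\<sigma> t)) (\<sigma>' t)" if "t \<in> I" for t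
  proof -
    have "(\<gamma> has_derivative (\<lambda>h. h *\<^sub>R frechet_derivative P (at (\<sigma> t)) (\<sigma>' t))) (at t)"
      by (rule has_derivative_transform_within_open[OF chain[OF smooth_P that] \<open>open I\<close> that])
        (simp add: \<gamma>\<sigma>)
    then show ?thesis
      unfolding \<gamma>'_def by (intro vector_derivative_at) (simp add: has_vector_derivative_def)
  qed
  have \<gamma>'0: "\<gamma>' 0 = vector [s$2 - \<alpha> * s$1, 0]"
    using \<gamma>'_eq[OF \<open>0 \<in> I\<close>] by (simp add: \<sigma>0 dP zero dp1_0 dp2_0 s_def)
  then have horizontal: "s$2 - \<alpha> * s$1 \<noteq> 0"
    using reg[OF \<open>0 \<in> I\<close>] by (auto simp: \<gamma>'_def vector_2_eq_0_iff)
  have "((\<lambda>t. 0) has_derivative (\<lambda>h. h *\<^sub>R frechet_derivative D (at (\<sigma> 0)) (\<sigma>' 0))) (at 0)"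
    by (rule has_derivative_transform_within_open[OF chain[OF smooth_D \<open>0 \<in> I\<close>] \<open>open I\<close> \<open>0 \<in> I\<close>])
      (rule \<sigma>I(2))
  from fun_cong[OF has_derivative_unique[OF this has_derivative_const], of 1]
  have conj: "second_deriv p2 u s = 0" by (simp add: \<sigma>0 dD_0 s_def)
  define \<gamma>'' where "\<gamma>'' = vector_derivative \<gamma>' (at 0)"
  have "\<gamma>'' $ 2 = second_deriv p2 s s"
  proof -
    have nth: "((\<lambda>t. \<sigma>' t $ i) has_derivative frechet_derivative (\<lambda>t. \<sigma>' t $ i) (at 0)) (at 0)" for i
      by (rule smooth_on_has_derivative[OF smooth_on_nth[OF smooth'(1)] \<open>0 \<in> I\<close>])
    have pd: "((\<lambda>t. pd p2 i (\<sigma> t)) has_derivative (\<lambda>h. h * second_deriv p2 (axis i 1) s)) (at 0)" for i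
      using chain[OF smooth_pd(2) \<open>0 \<in> I\<close>, of i] by (simp add: \<sigma>0 s_def second_deriv_def)
    have "((\<lambda>t. \<sigma>' t $ 1 * pd p2 1 (\<sigma> t) + \<sigma>' t $ 2 * pd p2 2 (\<sigma> t)) has_derivative (\<lambda>h.
        (\<sigma>' 0 $ 1 * (h * second_deriv p2 (axis 1 1) s)
          + frechet_derivative (\<lambda>t. \<sigma>' t $ 1) (at 0) h * pd p2 1 (\<sigma> 0))
      + (\<sigma>' 0 $ 2 * (h * second_deriv p2 (axis 2 1) s)
          + frechet_derivative (\<lambda>t. \<sigma>' t $ 2) (at 0) h * pd p2 2 (\<sigma> 0)))) (at 0)"
      by (intro has_derivative_add has_derivative_mult nth pd)
    then have "((\<lambda>t. \<sigma>' t $ 1 * pd p2 1 (\<sigma> t) + \<sigma>' t $ 2 * pd p2 2 (\<sigma> t)) has_derivative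
        (\<lambda>h. h * (s $ 1 * second_deriv p2 (axis 1 1) s + s $ 2 * second_deriv p2 (axis 2 1) s))) (at 0)"
      by (simp add: \<sigma>0 dp2_0 s_def algebra_simps)
    moreover have "s $ 1 * second_deriv p2 (axis 1 1) s + s $ 2 * second_deriv p2 (axis 2 1) s
        = second_deriv p2 s s"
      unfolding second_deriv_2[OF smooth2 zero, of s s] second_deriv_2[OF smooth2 zero, of "axis i 1" s for i]
      by simp
    ultimately have 1: "((\<lambda>t. \<sigma>' t $ 1 * pd p2 1 (\<sigma> t) + \<sigma>' t $ 2 * pd p2 2 (\<sigma> t)) has_derivative
        (\<lambda>h. h * second_deriv p2 s s)) (at 0)" by simp
    have 1: "((\<lambda>t. \<gamma>' t $ 2) has_derivative (\<lambda>h. h * second_deriv p2 s s)) (at 0)"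
      by (rule has_derivative_transform_within_open[OF 1 \<open>open I\<close> \<open>0 \<in> I\<close>])
        (simp add: \<gamma>'_eq dP \<sigma>I(1) frechet_derivative_2[OF smooth2, of "\<sigma> t" "\<sigma>' t" for t])
    have 2: "((\<lambda>t. \<gamma>' t $ 2) has_derivative (\<lambda>h. (h *\<^sub>R \<gamma>'') $ 2)) (at 0)"
      unfolding \<gamma>''_def
      by (rule bounded_linear.has_derivative[OF bounded_linear_vec_nth vd(2)[OF smooth'(2) \<open>0 \<in> I\<close>]])
    show ?thesis using fun_cong[OF has_derivative_unique[OF 2 1], of 1] by simp
  qed
  then have "plane_curvature \<gamma> 0 = 0 \<longleftrightarrow> second_deriv p2 s s = 0"
    using horizontal \<gamma>'0 unfolding plane_curvature_def Let_def \<gamma>''_def \<gamma>'_def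
    by (simp add: vector_2_eq_0_iff)
  also have "\<dots> \<longleftrightarrow> det (hessian p2) = 0"
  proof -
    have "second_deriv p2 u u * second_deriv p2 s s - second_deriv p2 u s * second_deriv p2 s u
        = det (hessian p2) * (s$2 - \<alpha> * s$1)\<^sup>2"
      unfolding second_deriv_2[OF smooth2 zero, of u u] second_deriv_2[OF smooth2 zero, of s s]
        second_deriv_2[OF smooth2 zero, of u s] second_deriv_2[OF smooth2 zero, of s u]
      by (simp add: det_2 hessian_def u_def power2_eq_square algebra_simps)
    then show ?thesis using Q conj horizontal by auto
  qed
  finally show ?thesis .
qed

theorem contour_inflection_iff:
  assumes "fold_germ P"
  shows "contour_inflection U P \<longleftrightarrow> det (hessian p2) = 0"
proof -
  have Q: "second_deriv p2 u u \<noteq> 0" using assms fold_germ_iff by simp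
  show ?thesis
    using contour_param_exists[OF Q] curvature_zero_iff[OF Q] unfolding contour_inflection_def
    by metis
qed

end

section \<open>Pencils of binary quadratic forms\<close>

text \<open>
  In the linear coordinates \<open>A x\<close> the quadratic form is \<open>a X\<^sup>2 + 2 b X Y + c Y\<^sup>2\<close>. The symmetry of
  the second derivative is needed here: values on the diagonal only determine the symmetric part.
\<close>

lemma det_hessian_of_quadratic_form:
  fixes A :: "real^2^2"
  assumes f: "smooth_on U f" "0 \<in> U"
    and q: "\<And>x. second_deriv f x x
      = a * ((A *v x)$1)\<^sup>2 + 2 * b * ((A *v x)$1 * (A *v x)$2) + c * ((A *v x)$2)\<^sup>2"
  shows "det (hessian f) = (a * c - b\<^sup>2) * (det A)\<^sup>2"
proof -
  define h where "h = (\<lambda>i j. second_deriv f (axis i 1) (axis j 1))"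
  have A: "(A *v x)$i = A$i$1 * x$1 + A$i$2 * x$2" for x i
    by (simp add: matrix_vector_mult_def sum_2)
  have sym: "h 2 1 = h 1 2" unfolding h_def by (rule second_deriv_symmetric[OF f])
  have d: "h i i = a * (A$1$i)\<^sup>2 + 2 * b * (A$1$i * A$2$i) + c * (A$2$i)\<^sup>2" for i
    unfolding h_def q A using exhaust_2[of i] by auto
  have "second_deriv f (vector [1, 1]) (vector [1, 1]) = h 1 1 + h 1 2 + (h 2 1 + h 2 2)"
    unfolding second_deriv_2[OF f, of "vector [1, 1]"] h_def by simp
  then have "2 * h 1 2 = 2 * (a * (A$1$1 * A$1$2) + b * (A$1$1 * A$2$2 + A$1$2 * A$2$1)
      + c * (A$2$1 * A$2$2))"
    unfolding q A sym by (simp add: d power2_eq_square algebra_simps)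
  then have m: "h 1 2 = a * (A$1$1 * A$1$2) + b * (A$1$1 * A$2$2 + A$1$2 * A$2$1) + c * (A$2$1 * A$2$2)"
    by simp
  have "det (hessian f) = h 1 1 * h 2 2 - h 1 2 * h 2 1"
    by (simp add: det_2 hessian_def h_def)
  then show ?thesis
    unfolding sym m d det_2[of A] by algebra
qed

lemma second_deriv_combination:
  assumes "smooth_on U f1" "smooth_on U f2" "0 \<in> U"
  shows "second_deriv (\<lambda>x. \<beta> * f1 x - \<mu> * f2 x) a b = \<beta> * second_deriv f1 a b - \<mu> * second_deriv f2 a b"
proof -
  have first: "frechet_derivative (\<lambda>x. \<beta> * f1 x - \<mu> * f2 x) (at x) a
      = \<beta> * frechet_derivative f1 (at x) a - \<mu> * frechet_derivative f2 (at x) a" if "x \<in> U" for x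
    by (rule frechet_derivative_eqI)
      (intro has_derivative_diff has_derivative_mult_right smooth_on_has_derivative[OF _ that] assms)
  have "((\<lambda>x. frechet_derivative (\<lambda>x. \<beta> * f1 x - \<mu> * f2 x) (at x) a) has_derivative
      (\<lambda>b. \<beta> * second_deriv f1 a b - \<mu> * second_deriv f2 a b)) (at 0)"
  proof (rule has_derivative_transform_within_open)
    show "((\<lambda>x. \<beta> * frechet_derivative f1 (at x) a - \<mu> * frechet_derivative f2 (at x) a) has_derivative
        (\<lambda>b. \<beta> * second_deriv f1 a b - \<mu> * second_deriv f2 a b)) (at 0)"
      by (intro has_derivative_diff has_derivative_mult_right has_derivative_second_deriv[OF _ assms(3)] assms)
    show "open U" using assms(1) by (simp add: smooth_on_def)
  qed (use assms(3) first in auto)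
  then show ?thesis
    unfolding second_deriv_def[of "\<lambda>x. \<beta> * f1 x - \<mu> * f2 x"] by (rule frechet_derivative_eqI)
qed

lemma second_deriv_pencil:
  assumes "smooth_on U f1" "smooth_on U f2" "0 \<in> U" and jet: "\<And>x. jet2 f1 f2 x = B *v N (A *v x)"
  shows "second_deriv (\<lambda>x. \<beta> * f1 x - \<mu> * f2 x) x x = 2 * ((vector [\<beta>, - \<mu>] v* B) \<bullet> N (A *v x))"
proof -
  have "second_deriv (\<lambda>x. \<beta> * f1 x - \<mu> * f2 x) x x = 2 * (vector [\<beta>, - \<mu>] \<bullet> jet2 f1 f2 x)"
    by (simp add: second_deriv_combination[OF assms(1-3)] jet2_def inner_vec_def sum_2)
  then show ?thesis by (simp add: jet dot_lmul_matrix)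
qed

lemma vector_matrix_mult_invertible_0:
  fixes B :: "real^'n^'n"
  assumes "invertible B" "w v* B = 0"
  shows "w = 0"
proof -
  obtain B' where B': "B ** B' = mat 1" using assms(1) unfolding invertible_def by blast
  have "w v* (B ** B') = 0" using assms(2) by (simp flip: vector_matrix_mul_assoc)
  then show ?thesis by (simp add: B')
qed

text \<open>
  For the elliptic normal form the pencil consists of the forms \<open>c\<^sub>1 (X\<^sup>2 - Y\<^sup>2) + c\<^sub>2 X Y\<close>, of
  determinant \<open>- c\<^sub>1\<^sup>2 - c\<^sub>2\<^sup>2 / 4\<close>; at an inflection point it consists of the multiples of one
  nondegenerate form.
\<close>

lemma nondegenerate_if_elliptic_or_inflection:
  assumes f: "smooth_on U f1" "smooth_on U f2" "0 \<in> U"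
    and "elliptic_point f1 f2 \<or> inflection_point f1 f2" and "\<mu>\<^sup>2 + \<beta>\<^sup>2 \<noteq> 0"
    and nz: "second_deriv (\<lambda>x. \<beta> * f1 x - \<mu> * f2 x) v v \<noteq> 0"
  shows "det (hessian (\<lambda>x. \<beta> * f1 x - \<mu> * f2 x)) \<noteq> 0"
proof -
  let ?p = "\<lambda>x. \<beta> * f1 x - \<mu> * f2 x"
  have p: "smooth_on U ?p" by (intro smooth_on_diff smooth_on_cmult f)
  note q = second_deriv_pencil[OF f, where \<beta>=\<beta> and \<mu>=\<mu>]
  note det = det_hessian_of_quadratic_form[OF p f(3)]
  from assms(4) consider
      (elliptic) A B :: "real^2^2" where "invertible A" "invertible B"
        "\<And>x. jet2 f1 f2 x = B *v (\<lambda>x. vector [(x$1)\<^sup>2 - (x$2)\<^sup>2, x$1 * x$2]) (A *v x)"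
    | (definite) A B :: "real^2^2" where "invertible A"
        "\<And>x. jet2 f1 f2 x = B *v (\<lambda>x. vector [(x$1)\<^sup>2 + (x$2)\<^sup>2, 0]) (A *v x)"
    | (indefinite) A B :: "real^2^2" where "invertible A"
        "\<And>x. jet2 f1 f2 x = B *v (\<lambda>x. vector [x$1 * x$2, 0]) (A *v x)"
    unfolding elliptic_point_def inflection_point_def GL2_equiv_def by blast
  then show ?thesis
  proof cases
    case (elliptic A B)
    define c where "c = vector [\<beta>, - \<mu>] v* B"
    have "c \<noteq> 0"
      using vector_matrix_mult_invertible_0[OF elliptic(2), of "vector [\<beta>, - \<mu>]"] assms(5) by (auto simp: c_def vector_2_eq_0_iff)
    then have "(c$1)\<^sup>2 + (c$2 / 2)\<^sup>2 > 0" by (auto simp: vec_eq_iff forall_2 sum_power2_gt_zero_iff)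
    moreover have "det (hessian ?p) = (2 * c$1 * (- 2 * c$1) - (c$2)\<^sup>2) * (det A)\<^sup>2"
      by (rule det) (simp add: q[OF elliptic(3)] c_def[symmetric] inner_vec_def sum_2 algebra_simps)
    moreover have "2 * c$1 * (- 2 * c$1) - (c$2)\<^sup>2 = - 4 * ((c$1)\<^sup>2 + (c$2 / 2)\<^sup>2)"
      by (simp add: power2_eq_square)
    ultimately show ?thesis using elliptic(1) by (simp add: invertible_det_nz)
  next
    case (definite A B)
    define c where "c = vector [\<beta>, - \<mu>] v* B"
    have q: "second_deriv ?p x x = 2 * c$1 * (((A *v x)$1)\<^sup>2 + ((A *v x)$2)\<^sup>2)" for x
      by (simp add: q[OF definite(2)] c_def[symmetric] inner_vec_def sum_2)
    have "det (hessian ?p) = (2 * c$1 * (2 * c$1) - 0\<^sup>2) * (det A)\<^sup>2"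
      by (rule det) (simp add: q algebra_simps)
    moreover have "c$1 \<noteq> 0" using nz q by auto
    ultimately show ?thesis using definite(1) by (simp add: invertible_det_nz)
  next
    case (indefinite A B)
    define c where "c = vector [\<beta>, - \<mu>] v* B"
    have q: "second_deriv ?p x x = 2 * c$1 * ((A *v x)$1 * (A *v x)$2)" for x
      by (simp add: q[OF indefinite(2)] c_def[symmetric] inner_vec_def sum_2)
    have "det (hessian ?p) = (0 * 0 - (c$1)\<^sup>2) * (det A)\<^sup>2"
      by (rule det) (simp add: q)
    moreover have "c$1 \<noteq> 0" using nz q by auto
    ultimately show ?thesis using indefinite(1) by (simp add: invertible_det_nz)
  qed
qed

text \<open>
  The hyperbolic and the parabolic pencils both contain the square of a nonzero linear form, which
  is a degenerate form; a direction \<open>(1, \<alpha>)\<close> outside the kernel of the linear form exists.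
\<close>

lemma degenerate_if_hyperbolic_or_parabolic:
  assumes f: "smooth_on U f1" "smooth_on U f2" "0 \<in> U"
    and "hyperbolic_point f1 f2 \<or> parabolic_point f1 f2"
  obtains \<alpha> \<mu> \<beta> where "\<mu>\<^sup>2 + \<beta>\<^sup>2 \<noteq> 0" "det (hessian (\<lambda>x. \<beta> * f1 x - \<mu> * f2 x)) = 0"
    "second_deriv (\<lambda>x. \<beta> * f1 x - \<mu> * f2 x) (vector [1, \<alpha>]) (vector [1, \<alpha>]) \<noteq> 0"
proof -
  obtain A B N i where inv: "invertible (A :: real^2^2)" "invertible B"
    and jet: "\<And>x. jet2 f1 f2 x = B *v N (A *v x)" and N: "\<And>x. N x $ i = (x $ i)\<^sup>2"
    using assms(4)
  proof
    assume "hyperbolic_point f1 f2"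
    then obtain A B :: "real^2^2" where "invertible A" "invertible B"
      "\<And>x. jet2 f1 f2 x = B *v (\<lambda>x. vector [(x$1)\<^sup>2, (x$2)\<^sup>2]) (A *v x)"
      unfolding hyperbolic_point_def GL2_equiv_def by blast
    then show ?thesis by (rule that[where i=1]) simp
  next
    assume "parabolic_point f1 f2"
    then obtain A B :: "real^2^2" where "invertible A" "invertible B"
      "\<And>x. jet2 f1 f2 x = B *v (\<lambda>x. vector [x$1 * x$2, (x$2)\<^sup>2]) (A *v x)"
      unfolding parabolic_point_def GL2_equiv_def by blast
    then show ?thesis by (rule that[where i=2]) simp
  qed
  obtain B' where B': "B' ** B = mat 1" using inv(2) unfolding invertible_def by blast
  define w where "w = axis i 1 v* B'"
  define \<beta> \<mu> where "\<beta> = w$1" and "\<mu> = - w$2"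
  have w: "vector [\<beta>, - \<mu>] = w" by (simp add: \<beta>_def \<mu>_def vec_eq_iff forall_2)
  have "w v* B = axis i 1 v* (B' ** B)" by (simp add: w_def vector_matrix_mul_assoc)
  then have wB: "w v* B = axis i 1" by (simp add: B')
  let ?p = "\<lambda>x. \<beta> * f1 x - \<mu> * f2 x"
  have p: "smooth_on U ?p" by (intro smooth_on_diff smooth_on_cmult f)
  have q: "second_deriv ?p x x = 2 * ((A *v x)$i)\<^sup>2" for x
    using second_deriv_pencil[OF f jet, of \<beta> \<mu> x] by (simp add: w wB inner_axis' N)
  have "w \<noteq> 0"
  proof
    assume "w = 0"
    then show False using wB by (simp add: axis_eq_0_iff)
  qed
  then have "\<mu>\<^sup>2 + \<beta>\<^sup>2 \<noteq> 0" by (auto simp: \<beta>_def \<mu>_def vec_eq_iff forall_2)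
  moreover have "det (hessian ?p) = 0"
  proof -
    consider "i = 1" | "i = 2" using exhaust_2 by blast
    then show ?thesis
    proof cases
      case 1
      have "det (hessian ?p) = (2 * 0 - 0\<^sup>2) * (det A)\<^sup>2"
        by (rule det_hessian_of_quadratic_form[OF p f(3)]) (simp add: q 1)
      then show ?thesis by simp
    next
      case 2
      have "det (hessian ?p) = (0 * 2 - 0\<^sup>2) * (det A)\<^sup>2"
        by (rule det_hessian_of_quadratic_form[OF p f(3)]) (simp add: q 2)
      then show ?thesis by simp
    qed
  qed
  moreover obtain \<alpha> where "(A *v vector [1, \<alpha>]) $ i \<noteq> 0"
  proof -
    have A: "(A *v vector [1, \<alpha>]) $ i = A$i$1 + A$i$2 * \<alpha>" for \<alpha>
      by (simp add: matrix_vector_mult_def sum_2)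
    have "A$i$1 \<noteq> 0 \<or> A$i$2 \<noteq> 0"
      using inv(1) exhaust_2[of i] unfolding invertible_det_nz det_2 by auto
    then show ?thesis using that[of 0] that[of 1] unfolding A by fastforce
  qed
  ultimately show ?thesis using that[of \<mu> \<beta> \<alpha>] by (simp add: q)
qed

section \<open>Projections of surfaces in Monge form\<close>

lemma binormal_dir_w:
  assumes "\<mu>\<^sup>2 + \<beta>\<^sup>2 \<noteq> 0"
  shows "binormal f1 f2 (dir_w \<mu> \<beta>) \<longleftrightarrow> det (hessian (\<lambda>x. \<beta> * f1 x - \<mu> * f2 x)) = 0"
proof -
  have "dir_w \<mu> \<beta> = \<beta> *\<^sub>R axis 3 1 + (- \<mu>) *\<^sub>R axis 4 1"
    by (simp add: dir_w_def vec_eq_iff forall_4 axis_def vector_def)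
  then have "dir_w \<mu> \<beta> \<in> normal_plane"
    unfolding normal_plane_def by (metis span_add span_base span_scale insertI1 insertI2)
  moreover have "dir_w \<mu> \<beta> \<noteq> 0"
    using assms by (auto simp: dir_w_def vec_eq_iff forall_4 vector_def)
  moreover have "height f1 f2 (dir_w \<mu> \<beta>) = (\<lambda>x. \<beta> * f1 x - \<mu> * f2 x)"
    by (simp add: fun_eq_iff height_def monge_def dir_w_def inner_vec_def sum_4 vector_def)
  ultimately show ?thesis by (simp add: binormal_def)
qed

text \<open>
  All terms containing \<open>f1\<close> and \<open>f2\<close> are of second order, so that the differential at the origin is
  that of \<open>(y - \<alpha> x, 0)\<close>.
\<close>

lemma corank_one_germ_surf_proj:
  assumes f: "smooth_on U f1" "smooth_on U f2" "0 \<in> U" and jet: "zero_1jet f1" "zero_1jet f2"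
  shows "corank_one_germ U
    (\<lambda>x. x$2 - \<alpha> * x$1 - l / (\<mu>\<^sup>2 + \<beta>\<^sup>2) * (\<mu> * f1 x + \<beta> * f2 x)) (\<lambda>x. \<beta> * f1 x - \<mu> * f2 x) \<alpha>"
proof
  have "open U" using f(1) by (simp add: smooth_on_def)
  have f_0: "f1 0 = 0" "f2 0 = 0" and
    d: "(f1 has_derivative (\<lambda>_. 0)) (at 0)" "(f2 has_derivative (\<lambda>_. 0)) (at 0)"
    using jet by (simp_all add: zero_1jet_def)
  have nth: "((\<lambda>x::real^2. x $ i) has_derivative (\<lambda>v. v $ i)) (at 0)" for i
    by (rule bounded_linear_imp_has_derivative[OF bounded_linear_vec_nth])
  show "smooth_on U (\<lambda>x. x$2 - \<alpha> * x$1 - l / (\<mu>\<^sup>2 + \<beta>\<^sup>2) * (\<mu> * f1 x + \<beta> * f2 x))"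
    by (intro smooth_on_diff smooth_on_add smooth_on_cmult smooth_on_nth smooth_on_id f \<open>open U\<close>)
  show "smooth_on U (\<lambda>x. \<beta> * f1 x - \<mu> * f2 x)"
    by (intro smooth_on_diff smooth_on_cmult f)
  have "((\<lambda>x. x$2 - \<alpha> * x$1 - l / (\<mu>\<^sup>2 + \<beta>\<^sup>2) * (\<mu> * f1 x + \<beta> * f2 x)) has_derivative
      (\<lambda>v. v$2 - \<alpha> * v$1 - l / (\<mu>\<^sup>2 + \<beta>\<^sup>2) * (\<mu> * 0 + \<beta> * 0))) (at 0)"
    by (intro has_derivative_diff has_derivative_add has_derivative_mult_right nth d)
  then show "frechet_derivative
      (\<lambda>x. x$2 - \<alpha> * x$1 - l / (\<mu>\<^sup>2 + \<beta>\<^sup>2) * (\<mu> * f1 x + \<beta> * f2 x)) (at 0) v = v$2 - \<alpha> * v$1" for v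
    by (simp add: frechet_derivative_eqI)
  have "((\<lambda>x. \<beta> * f1 x - \<mu> * f2 x) has_derivative (\<lambda>v. \<beta> * 0 - \<mu> * 0)) (at 0)"
    by (intro has_derivative_diff has_derivative_mult_right d)
  then show "frechet_derivative (\<lambda>x. \<beta> * f1 x - \<mu> * f2 x) (at 0) v = 0" for v
    by (simp add: frechet_derivative_eqI)
qed (use f jet in \<open>simp_all add: zero_1jet_def\<close>)

lemma surf_proj_germ:
  assumes "smooth_on U f1" "smooth_on U f2" "0 \<in> U" "zero_1jet f1" "zero_1jet f2"
  shows fold_germ_surf_proj_iff: "fold_germ (surf_proj f1 f2 \<alpha> l \<mu> \<beta>) \<longleftrightarrow>
      second_deriv (\<lambda>x. \<beta> * f1 x - \<mu> * f2 x) (vector [1, \<alpha>]) (vector [1, \<alpha>]) \<noteq> 0"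
    and contour_inflection_surf_proj_iff: "fold_germ (surf_proj f1 f2 \<alpha> l \<mu> \<beta>) \<Longrightarrow>
      contour_inflection U (surf_proj f1 f2 \<alpha> l \<mu> \<beta>) \<longleftrightarrow>
      det (hessian (\<lambda>x. \<beta> * f1 x - \<mu> * f2 x)) = 0"
proof -
  interpret corank_one_germ U
    "\<lambda>x. x$2 - \<alpha> * x$1 - l / (\<mu>\<^sup>2 + \<beta>\<^sup>2) * (\<mu> * f1 x + \<beta> * f2 x)" "\<lambda>x. \<beta> * f1 x - \<mu> * f2 x" \<alpha>
    by (rule corank_one_germ_surf_proj[OF assms])
  have P: "surf_proj f1 f2 \<alpha> l \<mu> \<beta> = P"
    unfolding fun_eq_iff P_def surf_proj_def proj_along_def monge_def
    by (simp add: vector_def)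
  show "fold_germ (surf_proj f1 f2 \<alpha> l \<mu> \<beta>) \<longleftrightarrow>
      second_deriv (\<lambda>x. \<beta> * f1 x - \<mu> * f2 x) (vector [1, \<alpha>]) (vector [1, \<alpha>]) \<noteq> 0"
    unfolding P fold_germ_iff u_def ..
  show "contour_inflection U (surf_proj f1 f2 \<alpha> l \<mu> \<beta>) \<longleftrightarrow>
      det (hessian (\<lambda>x. \<beta> * f1 x - \<mu> * f2 x)) = 0" if "fold_germ (surf_proj f1 f2 \<alpha> l \<mu> \<beta>)"
    using contour_inflection_iff that unfolding P .
qed

theorem corollary4p1:
  fixes f1 f2 :: "real^2 \<Rightarrow> real" and U :: "(real^2) set"
  assumes "open U" and "0 \<in> U"
    and "smooth_on U f1" and "smooth_on U f2"
    and "zero_1jet f1" and "zero_1jet f2"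
    and "generic_2jet f1 f2"
  shows
    "(elliptic_point f1 f2 \<or> inflection_point f1 f2 \<longleftrightarrow>
       (\<forall>\<alpha> l \<mu> \<beta>. \<mu>\<^sup>2 + \<beta>\<^sup>2 \<noteq> 0 \<and> fold_germ (surf_proj f1 f2 \<alpha> l \<mu> \<beta>) \<longrightarrow>
          \<not> contour_inflection U (surf_proj f1 f2 \<alpha> l \<mu> \<beta>))) \<and>
     (\<forall>\<alpha> l \<mu> \<beta>. \<mu>\<^sup>2 + \<beta>\<^sup>2 \<noteq> 0 \<and> fold_germ (surf_proj f1 f2 \<alpha> l \<mu> \<beta>) \<longrightarrow>
       ((hyperbolic_point f1 f2 \<or> parabolic_point f1 f2) \<and> binormal f1 f2 (dir_w \<mu> \<beta>) \<longleftrightarrow>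
        contour_inflection U (surf_proj f1 f2 \<alpha> l \<mu> \<beta>)))"
proof -
  let ?ei = "elliptic_point f1 f2 \<or> inflection_point f1 f2"
  let ?hp = "hyperbolic_point f1 f2 \<or> parabolic_point f1 f2"
  note f = assms(3,4,2) and germ = surf_proj_germ[OF assms(3,4,2,5,6)]
  have generic: "?hp \<or> ?ei" using assms(7) by (auto simp: generic_2jet_def)
  have no_inflection: "\<not> contour_inflection U (surf_proj f1 f2 \<alpha> l \<mu> \<beta>)"
    if ?ei "\<mu>\<^sup>2 + \<beta>\<^sup>2 \<noteq> 0" "fold_germ (surf_proj f1 f2 \<alpha> l \<mu> \<beta>)" for \<alpha> l \<mu> \<beta>
    using nondegenerate_if_elliptic_or_inflection[OF f that(1,2)] germ(1) germ(2)[OF that(3)] that(3)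
    by blast
  have inflection: "\<exists>\<alpha> l \<mu> \<beta>. \<mu>\<^sup>2 + \<beta>\<^sup>2 \<noteq> 0 \<and> fold_germ (surf_proj f1 f2 \<alpha> l \<mu> \<beta>) \<and>
      contour_inflection U (surf_proj f1 f2 \<alpha> l \<mu> \<beta>)" if ?hp
  proof -
    obtain \<alpha> \<mu> \<beta> where *: "\<mu>\<^sup>2 + \<beta>\<^sup>2 \<noteq> 0" "det (hessian (\<lambda>x. \<beta> * f1 x - \<mu> * f2 x)) = 0"
      "second_deriv (\<lambda>x. \<beta> * f1 x - \<mu> * f2 x) (vector [1, \<alpha>]) (vector [1, \<alpha>]) \<noteq> 0"
      using degenerate_if_hyperbolic_or_parabolic[OF f \<open>?hp\<close>] .
    have "fold_germ (surf_proj f1 f2 \<alpha> 0 \<mu> \<beta>)" using *(3) germ(1) by blast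
    then show ?thesis using *(1,2) germ(2) by blast
  qed
  have "?ei \<longleftrightarrow> (\<forall>\<alpha> l \<mu> \<beta>. \<mu>\<^sup>2 + \<beta>\<^sup>2 \<noteq> 0 \<and> fold_germ (surf_proj f1 f2 \<alpha> l \<mu> \<beta>) \<longrightarrow>
      \<not> contour_inflection U (surf_proj f1 f2 \<alpha> l \<mu> \<beta>))"
    using no_inflection inflection generic by blast
  moreover have "?hp \<and> binormal f1 f2 (dir_w \<mu> \<beta>) \<longleftrightarrow> contour_inflection U (surf_proj f1 f2 \<alpha> l \<mu> \<beta>)"
    if "\<mu>\<^sup>2 + \<beta>\<^sup>2 \<noteq> 0" "fold_germ (surf_proj f1 f2 \<alpha> l \<mu> \<beta>)" for \<alpha> l \<mu> \<beta>
    using no_inflection[OF _ that] generic germ(2)[OF that(2)] binormal_dir_w[OF that(1)] by blast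
  ultimately show ?thesis by blast
qed

end
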